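(* Let $r>0$ be real and $q=e^{-\pi\sqrt r}$. Then $$H(q)=-P+\sqrt{P^2+1},\qquad\text{where } P=\frac{k_r}{1-k'_r},$$ or equivalently $$k_r=\frac{4\left(H(q)-H(q)^3\right)}{\left(1+H(q)^2\right)^2}.$$
   Context: $K(x)=\int_0^{\pi/2}\frac{dt}{\sqrt{1-x^2\sin^2 t}}$ for $0\le x<1$. For real $r>0$, $k_r\in(0,1)$ is the unique solution $k$ of $K(\sqrt{1-k^2})/K(k)=\sqrt r$, and $k'_r=\sqrt{1-k_r^2}$. The Ramanujan-Göllnitz-Gordon continued fraction is, for $0<q<1$ (with the positive square root $q^{1/2}$), $$H(q)=\cfrac{q^{1/2}}{1+q+\cfrac{q^2}{1+q^3+\cfrac{q^4}{1+q^5+\cfrac{q^6}{1+q^7+\cdots}}}}.$$ *)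

theory Defs
  imports "HOL-Analysis.Analysis"
begin

definition ellK :: "real \<Rightarrow> real" where
  "ellK x = integral {0..pi/2} (\<lambda>t. 1 / sqrt (1 - x\<^sup>2 * (sin t)\<^sup>2))"

definition sing_mod :: "real \<Rightarrow> real" where
  "sing_mod r = (THE k. 0 < k \<and> k < 1 \<and> ellK (sqrt (1 - k\<^sup>2)) / ellK k = sqrt r)"

definition sing_mod_compl :: "real \<Rightarrow> real" where
  "sing_mod_compl r = sqrt (1 - (sing_mod r)\<^sup>2)"

(* The finite continued fraction a m / (b m + a (m+1) / (b (m+1) + ... + a (m+n-1) / b (m+n-1))),
   which has n levels and starts at index m. *)
primrec fin_cfrac :: "(nat \<Rightarrow> real) \<Rightarrow> (nat \<Rightarrow> real) \<Rightarrow> nat \<Rightarrow> nat \<Rightarrow> real" where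
  "fin_cfrac a b 0 m = 0"
| "fin_cfrac a b (Suc n) m = a m / (b m + fin_cfrac a b n (Suc m))"

definition inf_cfrac :: "(nat \<Rightarrow> real) \<Rightarrow> (nat \<Rightarrow> real) \<Rightarrow> real" where
  "inf_cfrac a b = lim (\<lambda>n. fin_cfrac a b n 0)"

definition rgg :: "real \<Rightarrow> real" where
  "rgg q = inf_cfrac (\<lambda>n. if n = 0 then sqrt q else q ^ (2 * n)) (\<lambda>n. 1 + q ^ (2 * n + 1))"

end

theory Submission imports Defs begin

text \<open>
  The denominators of the continued fraction come from a three-term recurrence for \<open>q\<close>-series
  whose first two members are, by Euler's identity, the real and (up to the factor \<open>\<surd>q\<close>) the
  imaginary part of \<open>W = \<Prod>(1 + u\<^bsup>2j+1\<^esup>)\<close> with \<open>u = i \<surd>q\<close>. Hence \<open>rgg q\<close> is the tangent of the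
  argument of \<open>W\<close>. By the triple product, \<open>W\<^sup>2\<close> is a real multiple of \<open>\<Sum> u\<^bsup>n\<^sup>2\<^esup>\<close>, whose real and
  imaginary parts are \<open>\<theta>\<^sub>3(q\<^sup>2)\<close> and \<open>\<theta>\<^sub>2(q\<^sup>2)\<close>; so \<open>2H / (1 - H\<^sup>2) = \<theta>\<^sub>2(q\<^sup>2) / \<theta>\<^sub>3(q\<^sup>2)\<close>, and the
  duplication formulas turn this into the claimed relation with \<open>k = \<theta>\<^sub>2(q)\<^sup>2 / \<theta>\<^sub>3(q)\<^sup>2\<close>.

  That this \<open>k\<close> is the singular modulus needs no modular transformation of theta functions: Landen's
  transformation gives \<open>K'/K\<close> at nome \<open>q\<^sup>2\<close> as twice its value at \<open>q\<close>, and iterating \<open>q \<mapsto> q\<^sup>2\<close> drives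
  \<open>k\<close> to \<open>0\<close>, where \<open>K'/K \<sim> (2/\<pi>) ln (1/k)\<close> determines the value.
\<close>

section \<open>The complete elliptic integral\<close>

lemma ellK_radicand_pos:
  fixes x t :: real
  assumes "\<bar>x\<bar> < 1"
  shows "0 < 1 - x\<^sup>2 * (sin t)\<^sup>2"
proof -
  have "(sin t)\<^sup>2 \<le> 1"
    by (simp add: abs_square_le_1)
  moreover have "x\<^sup>2 < 1"
    using assms by (simp add: abs_square_less_1)
  ultimately show ?thesis
    by (smt (verit) mult_left_le zero_le_power2)
qed

lemma continuous_on_ellK_integrand:
  fixes x :: real
  assumes "\<bar>x\<bar> < 1"
  shows "continuous_on A (\<lambda>t. 1 / sqrt (1 - x\<^sup>2 * (sin t)\<^sup>2))"
proof -
  have "sqrt (1 - x\<^sup>2 * (sin t)\<^sup>2) \<noteq> 0" for t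
    using ellK_radicand_pos[OF assms, of t] by simp
  then show ?thesis
    by (intro continuous_intros) auto
qed

lemma ellK_0: "ellK 0 = pi / 2"
  by (simp add: ellK_def)

lemma ellK_strict_mono:
  fixes x y :: real
  assumes "0 \<le> x" "x < y" "y < 1"
  shows "ellK x < ellK y"
  unfolding ellK_def
proof (rule integral_less_real)
  show "{0<..<pi/2} \<noteq> {}"
    by (simp add: not_le)
  fix t :: real
  assume t: "t \<in> {0<..<pi/2}"
  have "x\<^sup>2 < y\<^sup>2"
    using assms by (simp add: power_strict_mono)
  moreover have "0 < sin t"
    using t pi_gt_zero by (intro sin_gt_zero) auto
  ultimately have "x\<^sup>2 * (sin t)\<^sup>2 < y\<^sup>2 * (sin t)\<^sup>2"
    by simp
  then show "1 / sqrt (1 - x\<^sup>2 * (sin t)\<^sup>2) < 1 / sqrt (1 - y\<^sup>2 * (sin t)\<^sup>2)"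
    using ellK_radicand_pos[of y t] assms by (intro divide_strict_left_mono) auto
qed (use assms in \<open>auto intro!: continuous_on_ellK_integrand\<close>)

lemma ellK_ge:
  assumes "0 \<le> x" "x < 1"
  shows "pi / 2 \<le> ellK x"
  using ellK_strict_mono[of 0 x] assms by (cases "x = 0") (auto simp: ellK_0)

lemma ellK_pos:
  assumes "0 \<le> x" "x < 1"
  shows "0 < ellK x"
  using ellK_ge[OF assms] pi_gt_zero by linarith

lemma ellK_le:
  assumes "0 \<le> x" "x < 1"
  shows "ellK x \<le> pi / 2 / sqrt (1 - x\<^sup>2)"
proof -
  have "ellK x \<le> integral {0..pi/2} (\<lambda>t. 1 / sqrt (1 - x\<^sup>2))"
    unfolding ellK_def
  proof (rule integral_le)
    fix t :: real
    have "(sin t)\<^sup>2 \<le> 1"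
      by (simp add: abs_square_le_1)
    then have "x\<^sup>2 * (sin t)\<^sup>2 \<le> x\<^sup>2"
      by (simp add: mult_left_le)
    moreover have "x\<^sup>2 < 1"
      using assms by (simp add: abs_square_less_1)
    ultimately show "1 / sqrt (1 - x\<^sup>2 * (sin t)\<^sup>2) \<le> 1 / sqrt (1 - x\<^sup>2)"
      by (intro divide_left_mono) auto
  qed (use assms in \<open>auto intro!: integrable_continuous_real continuous_on_ellK_integrand\<close>)
  then show ?thesis
    by simp
qed

section \<open>Landen's transformation of the complete elliptic integral\<close>

text \<open>The integrand is symmetric about \<open>pi / 2\<close>, by a shift through
  \<open>pi\<close> and a reflection. The doubled interval is needed because Landen's substitution
  lets the new variable run over \<open>{0..pi}\<close>.\<close>

lemma integral_ellK_integrand_double: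
  assumes "\<bar>x\<bar> < 1"
  shows "integral {0..pi} (\<lambda>t. 1 / sqrt (1 - x\<^sup>2 * (sin t)\<^sup>2)) = 2 * ellK x"
proof -
  let ?f = "\<lambda>t. 1 / sqrt (1 - x\<^sup>2 * (sin t)\<^sup>2)"
  have int: "?f integrable_on {a..b}" for a b
    using assms by (intro integrable_continuous_real continuous_on_ellK_integrand)
  have "integral {-pi/2..0} (?f \<circ> (\<lambda>t. t + pi)) = integral {-pi/2 + pi..0 + pi} ?f"
    using assms by (intro integral_shift continuous_on_ellK_integrand)
  moreover have "?f \<circ> (\<lambda>t. t + pi) = (\<lambda>t. ?f (- t))"
    by (simp add: fun_eq_iff)
  moreover have "integral {-(pi/2)..-0} (\<lambda>t. ?f (- t)) = integral {0..pi/2} ?f"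
    by (rule Henstock_Kurzweil_Integration.integral_reflect_real[where f = ?f])
  ultimately have "integral {pi/2..pi} ?f = ellK x"
    by (simp add: ellK_def)
  moreover have "integral {0..pi/2} ?f + integral {pi/2..pi} ?f = integral {0..pi} ?f"
    using int by (intro Henstock_Kurzweil_Integration.integral_combine) auto
  ultimately show ?thesis
    by (simp add: ellK_def)
qed

text \<open>Landen's substitution \<open>2 \<psi> = \<phi> + arcsin (x sin \<phi>)\<close> maps \<open>[0, \<pi>]\<close> onto
  \<open>[0, \<pi>/2]\<close>.\<close>

lemma ellK_landen:
  fixes x :: real
  assumes "0 \<le> x" "x < 1"
  shows "ellK (2 * sqrt x / (1 + x)) = (1 + x) * ellK x"
proof -
  define k where "k = 2 * sqrt x / (1 + x)"
  define D where "D = (\<lambda>p. sqrt (1 - x\<^sup>2 * (sin p)\<^sup>2))"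
  define g where "g = (\<lambda>p. (p + arcsin (x * sin p)) / 2)"
  define g' where "g' = (\<lambda>p. (1 + x * cos p / D p) / 2)"
  define f where "f = (\<lambda>t. 1 / sqrt (1 - k\<^sup>2 * (sin t)\<^sup>2))"
  have k2: "k\<^sup>2 = 4 * x / (1 + x)\<^sup>2"
    using assms by (simp add: k_def power_divide power_mult_distrib)
  have "0 < (1 - x)\<^sup>2"
    using assms by simp
  then have "k\<^sup>2 < 1"
    unfolding k2 using assms by (simp add: divide_less_eq power2_eq_square algebra_simps)
  then have k: "\<bar>k\<bar> < 1"
    by (simp add: abs_square_less_1)
  have x: "\<bar>x\<bar> < 1"
    using assms by simp
  have Dpos: "0 < D p" and D2: "(D p)\<^sup>2 = 1 - x\<^sup>2 * (sin p)\<^sup>2" for p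
    using ellK_radicand_pos[OF x, of p] by (simp_all add: D_def)
  have xs: "\<bar>x * sin p\<bar> < 1" for p
  proof -
    have "\<bar>x\<bar> * \<bar>sin p\<bar> \<le> \<bar>x\<bar>"
      by (simp add: mult_left_le)
    then show ?thesis
      using x by (simp add: abs_mult)
  qed
  have deriv: "(g has_field_derivative g' p) (at p within {0..pi})" for p
    unfolding g_def g'_def D_def
    using xs[of p]
    by (auto intro!: derivative_eq_intros simp: abs_less_iff divide_simps power_mult_distrib mult_ac)
  have key: "g' p * f (g p) = (1 + x) / 2 * (1 / D p)" for p
  proof -
    have two_g: "2 * g p = p + arcsin (x * sin p)"
      by (simp add: g_def)
    have 1: "cos (2 * g p) = cos p * D p - x * (sin p)\<^sup>2"
      using xs[of p] unfolding two_g
      by (simp add: cos_add cos_arcsin abs_less_iff D_def power_mult_distrib power2_eq_square)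
    have 2: "(sin (g p))\<^sup>2 = (1 - cos (2 * g p)) / 2"
      by (simp add: cos_double_sin)
    have 3: "(cos p)\<^sup>2 = 1 - (sin p)\<^sup>2"
      by (simp add: cos_squared_eq)
    have "1 - k\<^sup>2 * (sin (g p))\<^sup>2 = ((1 + x)\<^sup>2 - 4 * x * (sin (g p))\<^sup>2) / (1 + x)\<^sup>2"
      using assms by (simp add: k2 divide_simps)
    \<comment> \<open>The radicand becomes a perfect square. This is why the substitution carries
      one elliptic integrand into a constant multiple of the other.\<close>
    also have "(1 + x)\<^sup>2 - 4 * x * (sin (g p))\<^sup>2 = (D p + x * cos p)\<^sup>2"
      unfolding 2 1 power2_sum D2 power_mult_distrib 3
      by (simp add: power2_eq_square algebra_simps diff_divide_distrib add_divide_distrib)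
    finally have 4: "1 - k\<^sup>2 * (sin (g p))\<^sup>2 = ((D p + x * cos p) / (1 + x))\<^sup>2"
      by (simp add: power_divide)
    have "(x * cos p)\<^sup>2 < (D p)\<^sup>2"
      using x by (simp add: D2 power_mult_distrib 3 algebra_simps abs_square_less_1)
    then have "\<bar>x * cos p\<bar> < D p"
      by (metis Dpos abs_of_pos power2_less_imp_less power2_abs less_imp_le)
    then have 5: "0 < D p + x * cos p"
      by linarith
    then have "f (g p) = (1 + x) / (D p + x * cos p)"
      using assms by (simp add: f_def 4 real_sqrt_divide)
    then show ?thesis
      using 5 Dpos[of p] by (simp add: g'_def divide_simps mult.commute)
  qed
  have "((\<lambda>p. g' p *\<^sub>R f (g p)) has_integral integral {g 0..g pi} f) {0..pi}"
  \<comment> \<open>The substitution rule only asks for an interval that contains the range of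
    \<open>g\<close> and on which \<open>f\<close> is continuous, so a crude one suffices.\<close>
  proof (rule has_integral_substitution[where c = "- pi" and d = "2 * pi"])
    show "g ` {0..pi} \<subseteq> {- pi..2 * pi}"
    proof clarsimp
      fix p :: real
      assume "0 \<le> p" "p \<le> pi"
      then show "- pi \<le> g p \<and> g p \<le> 2 * pi"
        using arcsin_bounded[of "x * sin p"] xs[of p] by (auto simp: g_def abs_less_iff field_simps)
    qed
  qed (use deriv k in \<open>auto simp: g_def f_def intro!: continuous_on_ellK_integrand\<close>)
  then have "integral {g 0..g pi} f = integral {0..pi} (\<lambda>p. (1 + x) / 2 * (1 / D p))"
    by (simp add: key integral_unique)
  also have "\<dots> = (1 + x) / 2 * integral {0..pi} (\<lambda>p. 1 / D p)"
    by (rule integral_mult_right)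
  also have "integral {0..pi} (\<lambda>p. 1 / D p) = 2 * ellK x"
    unfolding D_def using x by (rule integral_ellK_integrand_double)
  finally show ?thesis
    by (simp add: g_def f_def ellK_def k_def)
qed

text \<open>Landen's transformation is used twice: it takes \<open>x\<close> to \<open>k\<close>,
  and it takes the complementary modulus \<open>z = (1 - x) / (1 + x)\<close> of \<open>k\<close> to
  the complementary modulus of \<open>x\<close>. The factors \<open>1 + x\<close> and
  \<open>1 + z = 2 / (1 + x)\<close> combine to 2.\<close>

lemma ellK_ratio_landen:
  fixes x :: real
  assumes "0 < x" "x < 1"
  defines "k \<equiv> 2 * sqrt x / (1 + x)"
  shows "ellK (sqrt (1 - x\<^sup>2)) / ellK x = 2 * (ellK (sqrt (1 - k\<^sup>2)) / ellK k)"
proof -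
  define z where "z = (1 - x) / (1 + x)"
  have k2: "k\<^sup>2 = 4 * x / (1 + x)\<^sup>2"
    using assms by (simp add: k_def power_divide power_mult_distrib)
  have "1 - k\<^sup>2 = z\<^sup>2"
    using assms(1) by (simp add: k2 z_def power_divide divide_simps) (simp add: power2_eq_square algebra_simps)
  moreover have z: "0 < z" "z < 1"
    using assms by (auto simp: z_def)
  ultimately have zk: "sqrt (1 - k\<^sup>2) = z"
    by simp
  have 1: "1 + z = 2 / (1 + x)"
    using assms(1) by (simp add: z_def divide_simps)
  have "(2 * sqrt z / (1 + z))\<^sup>2 = 4 * z / (1 + z)\<^sup>2"
    using z by (simp add: power_divide power_mult_distrib)
  also have "\<dots> = 1 - x\<^sup>2"
    unfolding 1 using assms(1) by (simp add: z_def divide_simps) (simp add: power2_eq_square algebra_simps)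
  finally have "sqrt (1 - x\<^sup>2) = sqrt ((2 * sqrt z / (1 + z))\<^sup>2)"
    by simp
  then have "sqrt (1 - x\<^sup>2) = 2 * sqrt z / (1 + z)"
    using z by simp
  then have "ellK (sqrt (1 - x\<^sup>2)) = (1 + z) * ellK z"
    using ellK_landen[of z] z by simp
  moreover have "ellK k = (1 + x) * ellK x"
    unfolding k_def using assms by (intro ellK_landen) auto
  ultimately show ?thesis
    using assms(1) by (simp add: zk 1)
qed

text \<open>Multiplied by \<open>sin t\<close>, the integrand of \<open>ellK (sqrt (1 - k\<^sup>2))\<close> becomes
  elementary; the remaining part stays bounded because \<open>1 - sin t \<le> cos t\<close>.\<close>

lemma ellK_compl_bounds:
  fixes k :: real
  assumes "0 < k" "k < 1"
  defines "c \<equiv> sqrt (1 - k\<^sup>2)"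
  shows "ln (1 / k) \<le> ellK c" "ellK c \<le> (ln (2 / k) + pi / 2) / c"
proof -
  let ?f = "\<lambda>t. 1 / sqrt (1 - c\<^sup>2 * (sin t)\<^sup>2)"
  have "k\<^sup>2 < 1" "0 < k\<^sup>2"
    using assms by (simp_all add: abs_square_less_1)
  then have c: "0 < c" "c < 1" and c2: "c\<^sup>2 = 1 - k\<^sup>2"
    by (simp_all add: c_def)
  have cabs: "\<bar>c\<bar> < 1"
    using c by simp
  have pos: "0 < sqrt (1 - c\<^sup>2 * (sin t)\<^sup>2)" for t
    using ellK_radicand_pos[OF cabs] by simp
  have rad: "1 - c\<^sup>2 * (sin t)\<^sup>2 = k\<^sup>2 + c\<^sup>2 * (cos t)\<^sup>2" for t
    unfolding cos_squared_eq c2 by (simp add: algebra_simps)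
  have contf: "continuous_on A ?f" for A
    by (rule continuous_on_ellK_integrand[OF cabs])
  \<comment> \<open>Since the radicand equals \<open>k^2 + c^2 * cos^2 t\<close>, the substitution
    \<open>w = c * cos t / k\<close> turns the integral of \<open>sin t * ?f t\<close> into that of
    \<open>1 / sqrt (w^2 + 1)\<close>.\<close>
  let ?G = "\<lambda>t. - arsinh (c * cos t / k) / c"
  have deriv: "(?G has_vector_derivative sin t * ?f t) (at t within {0..pi/2})" for t
  proof -
    have "sqrt ((c * cos t / k)\<^sup>2 + 1) = sqrt ((k\<^sup>2 + c\<^sup>2 * (cos t)\<^sup>2) / k\<^sup>2)"
      using assms(1) by (simp add: power_divide power_mult_distrib add_divide_distrib add.commute)
    also have "\<dots> = sqrt (1 - c\<^sup>2 * (sin t)\<^sup>2) / k"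
      using assms(1) by (simp add: rad real_sqrt_divide)
    finally have "sqrt ((c * cos t / k)\<^sup>2 + 1) = sqrt (1 - c\<^sup>2 * (sin t)\<^sup>2) / k" .
    moreover have "((\<lambda>t. c * cos t / k) has_real_derivative - (c * sin t / k)) (at t within {0..pi/2})"
      using assms(1) by (auto intro!: derivative_eq_intros)
    note DERIV_cdivide[OF DERIV_minus[OF DERIV_chain2[OF arsinh_real_has_field_derivative this]], of c]
    ultimately have "(?G has_real_derivative sin t * ?f t) (at t within {0..pi/2})"
      using assms(1) c by (simp add: mult.commute)
    then show ?thesis
      by (simp add: has_real_derivative_iff_has_vector_derivative)
  qed
  have "((\<lambda>t. sin t * ?f t) has_integral (?G (pi/2) - ?G 0)) {0..pi/2}"
    by (rule fundamental_theorem_of_calculus) (use deriv in auto)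
  then have int: "((\<lambda>t. sin t * ?f t) has_integral (arsinh (c / k) / c)) {0..pi/2}"
    by simp
  have "(c / k)\<^sup>2 + 1 = (1 / k)\<^sup>2"
    using assms(1) by (simp add: power_divide c2 field_simps)
  then have "sqrt ((c / k)\<^sup>2 + 1) = 1 / k"
    using assms(1) by simp
  then have arsinh: "arsinh (c / k) = ln ((1 + c) / k)"
    by (simp add: arsinh_real_def add_divide_distrib add.commute)
  have intf: "(?f has_integral ellK c) {0..pi/2}"
    unfolding ellK_def using contf by (intro integrable_integral integrable_continuous_real)
  have l1: "0 \<le> ln (1 / k)"
    using assms(1,2) by simp
  have l2: "ln (1 / k) \<le> ln ((1 + c) / k)"
    using assms(1) c by (simp add: divide_right_mono)
  also have "ln ((1 + c) / k) \<le> ln ((1 + c) / k) / c"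
    using c l1 l2 by (simp add: le_divide_eq mult_left_le)
  also have "\<dots> \<le> ellK c"
    unfolding arsinh[symmetric]
  proof (rule has_integral_le[OF int intf])
    fix t :: real
    show "sin t * ?f t \<le> ?f t"
      using pos[of t] by (simp add: divide_right_mono)
  qed
  finally show "ln (1 / k) \<le> ellK c" .
  have "ellK c \<le> arsinh (c / k) / c + pi / 2 * (1 / c)"
  proof (rule has_integral_le[OF intf])
    have "((\<lambda>t. 1 / c) has_integral (pi / 2 * (1 / c))) {0..pi/2}"
      using has_integral_const_real[of "1 / c" 0 "pi / 2"] by simp
    then show "((\<lambda>t. sin t * ?f t + 1 / c) has_integral (arsinh (c / k) / c + pi / 2 * (1 / c))) {0..pi/2}"
      by (intro has_integral_add int)
    fix t :: real
    assume "t \<in> {0..pi/2}"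
    then have s: "0 \<le> sin t" "0 \<le> cos t"
      by (auto intro!: sin_ge_zero cos_ge_zero)
    have "(1 - sin t)\<^sup>2 \<le> (1 - sin t) * (1 + sin t)"
      using s by (simp add: power2_eq_square mult_left_mono)
    also have "\<dots> = (cos t)\<^sup>2"
      by (simp add: cos_squared_eq power2_eq_square algebra_simps)
    finally have "1 - sin t \<le> cos t"
      using s(2) by (rule power2_le_imp_le)
    moreover have "c * cos t \<le> sqrt (1 - c\<^sup>2 * (sin t)\<^sup>2)"
      unfolding rad by (rule real_le_rsqrt) (simp add: power_mult_distrib)
    ultimately have "c * (1 - sin t) \<le> sqrt (1 - c\<^sup>2 * (sin t)\<^sup>2)"
      using c by (smt (verit) mult_left_mono)
    then show "?f t \<le> sin t * ?f t + 1 / c"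
      using c pos[of t] by (simp add: field_simps)
  qed
  also have "\<dots> = (ln ((1 + c) / k) + pi / 2) / c"
    by (simp add: arsinh add_divide_distrib)
  also have "\<dots> \<le> (ln (2 / k) + pi / 2) / c"
    using c assms(1) by (simp add: divide_right_mono)
  finally show "ellK c \<le> (ln (2 / k) + pi / 2) / c" .
qed

text \<open>Division by \<open>pi / 2 \<le> ellK k \<le> pi / 2 / c\<close>. Both bounds behave like
  \<open>2 / pi * ln (1 / k)\<close> as \<open>k\<close> tends to 0, which is the only regime in
  which they are applied.\<close>

lemma ellK_ratio_bounds:
  fixes k :: real
  assumes "0 < k" "k < 1"
  defines "c \<equiv> sqrt (1 - k\<^sup>2)"
  shows "2 / pi * c * ln (1 / k) \<le> ellK c / ellK k"
    and "ellK c / ellK k \<le> (2 / pi * ln (2 / k) + 1) / c"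
proof -
  have "k\<^sup>2 < 1" "0 < k\<^sup>2"
    using assms by (simp_all add: abs_square_less_1)
  then have c: "0 < c" "c < 1"
    by (simp_all add: c_def)
  have K: "pi / 2 \<le> ellK k" "ellK k \<le> pi / 2 / c"
    using ellK_ge[of k] ellK_le[of k] assms by auto
  then have Kpos: "0 < ellK k"
    using pi_gt_zero by linarith
  have l: "0 < ln (1 / k)" "ln (1 / k) \<le> ln (2 / k)"
    using assms by (simp_all add: divide_right_mono)
  have b: "ln (1 / k) \<le> ellK c" "ellK c \<le> (ln (2 / k) + pi / 2) / c"
    using ellK_compl_bounds[of k] assms by auto
  have "2 / pi * c * ln (1 / k) = ln (1 / k) / (pi / 2 / c)"
    by simp
  also have "\<dots> \<le> ellK c / ellK k"
    using b K Kpos c l by (intro frac_le) auto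
  finally show "2 / pi * c * ln (1 / k) \<le> ellK c / ellK k" .
  have "ellK c / ellK k \<le> (ln (2 / k) + pi / 2) / c / (pi / 2)"
    using b K Kpos c l by (intro frac_le) auto
  also have "\<dots> = (2 / pi * ln (2 / k) + 1) / c"
    using c by (simp add: divide_simps)
  finally show "ellK c / ellK k \<le> (2 / pi * ln (2 / k) + 1) / c" .
qed

section \<open>Uniqueness of the singular modulus\<close>

text \<open>A larger modulus lowers the numerator and raises the denominator. Strictness supplies
  the uniqueness that the \<open>THE\<close> in \<open>sing_mod\<close> requires.\<close>

lemma ellK_ratio_strict_antimono:
  fixes x y :: real
  assumes "0 < x" "x < y" "y < 1"
  shows "ellK (sqrt (1 - y\<^sup>2)) / ellK y < ellK (sqrt (1 - x\<^sup>2)) / ellK x"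
proof -
  have sq: "0 < x\<^sup>2" "x\<^sup>2 < y\<^sup>2" "y\<^sup>2 < 1"
    using assms by (simp_all add: power_strict_mono abs_square_less_1)
  have "ellK (sqrt (1 - y\<^sup>2)) < ellK (sqrt (1 - x\<^sup>2))"
    using sq by (intro ellK_strict_mono) auto
  moreover have "ellK x < ellK y"
    using assms by (intro ellK_strict_mono) auto
  moreover have "0 < ellK x" "0 < ellK (sqrt (1 - y\<^sup>2))"
    using assms sq by (auto intro!: ellK_pos)
  ultimately show ?thesis
    by (intro frac_less) auto
qed

lemma sing_mod_eqI:
  assumes "0 < k" "k < 1" "ellK (sqrt (1 - k\<^sup>2)) / ellK k = sqrt r"
  shows "sing_mod r = k"
  unfolding sing_mod_def
proof (rule the_equality)
  fix l :: real
  assume l: "0 < l \<and> l < 1 \<and> ellK (sqrt (1 - l\<^sup>2)) / ellK l = sqrt r"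
  then show "l = k"
    using assms ellK_ratio_strict_antimono[of k l] ellK_ratio_strict_antimono[of l k]
    by (cases l k rule: linorder_cases) auto
qed (use assms in auto)

section \<open>Gaussian binomials and the theta product\<close>

lemma tendsto_prod_nonzero:
  fixes f :: "nat \<Rightarrow> complex"
  assumes "summable (\<lambda>n. norm (f n))" "\<And>n. 1 + f n \<noteq> 0"
  obtains L where "(\<lambda>N. \<Prod>n<N. 1 + f n) \<longlonglongrightarrow> L" "L \<noteq> 0"
proof -
  have "convergent_prod (\<lambda>n. 1 + f n)"
    using assms(1)
    by (intro abs_convergent_prod_imp_convergent_prod summable_imp_abs_convergent_prod) simp
  then obtain L where "(\<lambda>N. \<Prod>n\<le>N. 1 + f n) \<longlonglongrightarrow> L" "L \<noteq> 0"
    using convergent_prod_iff_nz_lim[of "\<lambda>n. 1 + f n"] assms(2) by auto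
  moreover have "(\<lambda>N. \<Prod>n<Suc N. 1 + f n) = (\<lambda>N. \<Prod>n\<le>N. 1 + f n)"
    by (simp add: lessThan_Suc_atMost)
  ultimately show ?thesis
    using that LIMSEQ_imp_Suc[of "\<lambda>N. \<Prod>n<N. 1 + f n" L] by simp
qed

text \<open>No factor vanishes because \<open>norm (x * p ^ n) < 1\<close>. The nonzero limit
  matters twice: it permits division by the limit of \<open>qfact\<close>, and it later excludes
  \<open>theta_tan q = 1\<close>.\<close>

lemma tendsto_prod_geometric_nonzero:
  fixes x p :: complex
  assumes "norm x < 1" "norm p < 1"
  obtains L where "(\<lambda>N. \<Prod>n<N. 1 + x * p ^ n) \<longlonglongrightarrow> L" "L \<noteq> 0"
proof (rule tendsto_prod_nonzero[of "\<lambda>n. x * p ^ n"])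
  show "summable (\<lambda>n. norm (x * p ^ n))"
    using assms by (simp add: norm_mult norm_power summable_mult summable_geometric)
  fix n
  have "norm (x * p ^ n) \<le> norm x"
    using assms by (simp add: norm_mult norm_power mult_left_le power_le_one)
  then have "norm (x * p ^ n) < 1"
    using assms by simp
  then show "1 + x * p ^ n \<noteq> 0"
    by (metis add_eq_0_iff norm_minus_cancel norm_one order_less_irrefl)
qed

section \<open>The finite q-binomial theorem\<close>

text \<open>The q-Pochhammer symbol \<open>(p; p)_n\<close>. The exponent \<open>Suc j\<close> keeps
  out the vanishing factor \<open>1 - p ^ 0\<close>.\<close>

definition qfact :: "complex \<Rightarrow> nat \<Rightarrow> complex" where
  "qfact p n = (\<Prod>j<n. 1 - p ^ Suc j)"

text \<open>The Gaussian binomial coefficient. The explicit zero for \<open>k > n\<close> is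
  essential, since truncated subtraction would otherwise leave
  \<open>qfact p n / qfact p k\<close>.\<close>

definition qbinomial :: "complex \<Rightarrow> nat \<Rightarrow> nat \<Rightarrow> complex" where
  "qbinomial p n k = (if k \<le> n then qfact p n / (qfact p k * qfact p (n - k)) else 0)"

lemma qfact_0 [simp]: "qfact p 0 = 1"
  by (simp add: qfact_def)

lemma qfact_Suc: "qfact p (Suc n) = qfact p n * (1 - p ^ Suc n)"
  by (simp add: qfact_def)

lemma one_minus_power_nonzero:
  fixes p :: complex
  assumes "norm p < 1" "0 < n"
  shows "1 - p ^ n \<noteq> 0"
proof
  assume "1 - p ^ n = 0"
  then have "norm p ^ n = 1"
    by (metis eq_iff_diff_eq_0 norm_one norm_power)
  then show False
    using assms power_less_one_iff[of "norm p" n] by simp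
qed

lemma qfact_nonzero: "norm p < 1 \<Longrightarrow> qfact p n \<noteq> 0"
  using one_minus_power_nonzero[of p] by (simp add: qfact_def del: power_Suc)

lemma qfact_tendsto:
  assumes "norm p < 1"
  obtains Q where "qfact p \<longlonglongrightarrow> Q" "Q \<noteq> 0"
proof -
  obtain L where "(\<lambda>N. \<Prod>n<N. 1 + (- p) * p ^ n) \<longlonglongrightarrow> L" "L \<noteq> 0"
    using tendsto_prod_geometric_nonzero[of "- p" p] assms by auto
  then show ?thesis
    using that by (simp add: qfact_def[abs_def])
qed

lemma qbinomial_0 [simp]: "norm p < 1 \<Longrightarrow> qbinomial p n 0 = 1"
  by (simp add: qbinomial_def qfact_nonzero)

text \<open>The q-Pascal rule. It comes from splitting the new factor \<open>1 - p ^ Suc n\<close>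
  as \<open>(1 - p ^ (n - k)) + p ^ (n - k) * (1 - p ^ Suc k)\<close>. The case \<open>k = n\<close>
  is separate because \<open>qbinomial p n (Suc n)\<close> is 0 by convention.\<close>

lemma qbinomial_Suc_Suc:
  assumes "norm p < 1" "k \<le> n"
  shows "qbinomial p (Suc n) (Suc k) = qbinomial p n (Suc k) + p ^ (n - k) * qbinomial p n k"
proof (cases "k = n")
  case True
  then show ?thesis
    using assms by (simp add: qbinomial_def qfact_nonzero)
next
  case False
  define m where "m = n - Suc k"
  have n: "n = k + Suc m"
    using assms False by (simp add: m_def)
  have nz: "qfact p i \<noteq> 0" "1 - p ^ Suc i \<noteq> 0" for i
    using assms one_minus_power_nonzero[of p "Suc i"] by (auto simp: qfact_nonzero)
  have eq: "1 - p ^ Suc n = (1 - p ^ Suc m) + p ^ Suc m * (1 - p ^ Suc k)"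
    by (simp add: n algebra_simps flip: power_add)
  have "F * (c + e * b) / ((K * b) * (M * c)) = F / ((K * b) * M) + e * (F / (K * (M * c)))"
    if "K \<noteq> 0" "M \<noteq> 0" "b \<noteq> 0" "c \<noteq> 0" for F K M b c e :: complex
    using that by (simp add: field_simps)
  from this[OF nz(1)[of k] nz(1)[of m] nz(2)[of k] nz(2)[of m], of "qfact p n" "p ^ Suc m"]
  have "qfact p n * ((1 - p ^ Suc m) + p ^ Suc m * (1 - p ^ Suc k)) / (qfact p (Suc k) * qfact p (Suc m)) =
      qfact p n / (qfact p (Suc k) * qfact p m) + p ^ Suc m * (qfact p n / (qfact p k * qfact p (Suc m)))"
    by (simp only: qfact_Suc)
  moreover have "qbinomial p (Suc n) (Suc k) = qfact p (Suc n) / (qfact p (Suc k) * qfact p (Suc m))"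
    "qbinomial p n (Suc k) = qfact p n / (qfact p (Suc k) * qfact p m)"
    "qbinomial p n k = qfact p n / (qfact p k * qfact p (Suc m))"
    by (simp_all add: qbinomial_def n)
  moreover have "n - k = Suc m"
    by (simp add: n)
  ultimately show ?thesis
    unfolding qfact_Suc[of p n] eq by (simp only:)
qed

text \<open>Induction on \<open>n\<close>: the new factor \<open>1 + x * p ^ n\<close> matches the
  q-Pascal rule because \<open>(Suc k choose 2) + (n - k) = (k choose 2) + n\<close>.\<close>

lemma qbinomial_theorem:
  assumes "norm p < 1"
  shows "(\<Prod>j<n. 1 + x * p ^ j) = (\<Sum>k\<le>n. p ^ (k choose 2) * qbinomial p n k * x ^ k)"
proof (induction n)
  case 0
  then show ?case by (simp add: assms binomial_eq_0)
next
  case (Suc n)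
  let ?c = "\<lambda>n k. p ^ (k choose 2) * qbinomial p n k * x ^ k"
  have step: "?c (Suc n) (Suc k) = ?c n (Suc k) + ?c n k * (x * p ^ n)" if "k \<le> n" for k
  proof -
    have "(Suc k choose 2) + (n - k) = (k choose 2) + n"
      using that by (simp add: numeral_2_eq_2)
    then have "p ^ (Suc k choose 2) * p ^ (n - k) = p ^ (k choose 2) * p ^ n"
      by (simp flip: power_add)
    then show ?thesis
      using assms that by (simp add: qbinomial_Suc_Suc algebra_simps)
  qed
  have "(\<Sum>k\<le>Suc n. ?c (Suc n) k) = 1 + (\<Sum>k\<le>n. ?c (Suc n) (Suc k))"
    using assms by (simp add: sum.atMost_Suc_shift binomial_eq_0 del: sum.atMost_Suc)
  also have "(\<Sum>k\<le>n. ?c (Suc n) (Suc k)) = (\<Sum>k\<le>n. ?c n (Suc k)) + (\<Sum>k\<le>n. ?c n k) * (x * p ^ n)"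
    using step by (simp add: sum.distrib sum_distrib_right)
  also have "1 + \<dots> = (\<Sum>k\<le>Suc n. ?c n k) + (\<Sum>k\<le>n. ?c n k) * (x * p ^ n)"
    using assms by (simp add: sum.atMost_Suc_shift binomial_eq_0 del: sum.atMost_Suc)
  also have "(\<Sum>k\<le>Suc n. ?c n k) = (\<Sum>k\<le>n. ?c n k)"
    by (simp add: qbinomial_def)
  finally show ?case
    by (simp add: Suc algebra_simps)
qed

text \<open>\<open>qfact p\<close> converges to a nonzero limit, so it and its inverse are bounded.
  The bound, uniform in both indices, provides the dominating series in the two limit passages
  below.\<close>

lemma qbinomial_bounded:
  assumes "norm p < 1"
  obtains C where "\<And>n k. norm (qbinomial p n k) \<le> C" "0 \<le> C"
proof -
  obtain Q where Q: "qfact p \<longlonglongrightarrow> Q" "Q \<noteq> 0"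
    using qfact_tendsto[OF assms] .
  obtain M where M: "0 < M" "\<And>n. norm (qfact p n) \<le> M"
    using convergent_imp_Bseq[OF convergentI[OF Q(1)]] by (auto simp: Bseq_def)
  obtain M' where M': "0 < M'" "\<And>n. norm (inverse (qfact p n)) \<le> M'"
    using convergent_imp_Bseq[OF convergentI[OF tendsto_inverse[OF Q]]] by (auto simp: Bseq_def)
  have "norm (qbinomial p n k) \<le> M * (M' * M')" for n k
  proof -
    have "norm (qfact p n) * (norm (inverse (qfact p k)) * norm (inverse (qfact p (n - k)))) \<le> M * (M' * M')"
      using M M' by (intro mult_mono) auto
    then show ?thesis
      using M M' by (simp add: qbinomial_def norm_mult norm_divide norm_inverse divide_inverse)
  qed
  then show ?thesis
    using that M M' by (metis less_imp_le mult_pos_pos)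
qed

lemma qbinomial_tendsto:
  assumes "norm p < 1"
  shows "(\<lambda>n. qbinomial p n k) \<longlonglongrightarrow> 1 / qfact p k"
proof -
  obtain Q where Q: "qfact p \<longlonglongrightarrow> Q" "Q \<noteq> 0"
    using qfact_tendsto[OF assms] .
  have "(\<lambda>n. qfact p (n + k) / (qfact p k * qfact p n)) \<longlonglongrightarrow> Q / (qfact p k * Q)"
    using Q assms by (intro tendsto_intros LIMSEQ_ignore_initial_segment) (auto simp: qfact_nonzero)
  then have "(\<lambda>n. qbinomial p (n + k) k) \<longlonglongrightarrow> 1 / qfact p k"
    using Q by (simp add: qbinomial_def)
  then show ?thesis
    by (rule LIMSEQ_offset)
qed

section \<open>Dominated convergence and Euler's product expansion\<close>

text \<open>Tannery's theorem: by the Weierstrass M-test the finite partial sums converge uniformly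
  in \<open>N\<close>, so the limit in \<open>N\<close> may be exchanged with the summation.\<close>

lemma tannery_has_sum:
  fixes f :: "nat \<Rightarrow> 'a \<Rightarrow> complex"
  assumes bound: "\<And>N n. norm (f N n) \<le> h n"
    and h: "h summable_on UNIV"
    and lim: "\<And>n. (\<lambda>N. f N n) \<longlonglongrightarrow> g n"
    and sum: "\<And>N. (f N has_sum S N) UNIV"
    and S: "S \<longlonglongrightarrow> L"
  shows "(g has_sum L) UNIV"
proof -
  have "norm (g n) \<le> h n" for n
    using bound by (intro tendsto_upperbound[OF tendsto_norm[OF lim]]) simp_all
  then have "(\<lambda>n. norm (g n)) summable_on UNIV"
    by (intro summable_on_comparison_test[OF h]) simp_all
  then have "g summable_on UNIV"
    by (rule abs_summable_summable)
  then have g: "(g has_sum infsum g UNIV) UNIV"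
    by (rule has_sum_infsum)
  have ul: "uniform_limit UNIV (\<lambda>X N. \<Sum>n\<in>X. f N n) S (finite_subsets_at_top UNIV)"
    by (rule Weierstrass_m_test_general'[where M = h]) (simp_all add: bound h sum)
  have "S \<longlonglongrightarrow> infsum g UNIV"
  proof (rule swap_uniform_limit'[OF _ _ ul])
    show "\<forall>\<^sub>F X in finite_subsets_at_top UNIV. (\<lambda>N. \<Sum>n\<in>X. f N n) \<longlonglongrightarrow> sum g X"
      by (intro always_eventually allI tendsto_sum lim)
    show "(sum g \<longlongrightarrow> infsum g UNIV) (finite_subsets_at_top UNIV)"
      using g by (simp only: has_sum_def)
  qed simp_all
  then have "infsum g UNIV = L"
    using S by (rule LIMSEQ_unique)
  then show ?thesis
    using g by simp
qed

text \<open>The limit of the finite q-binomial theorem, dominated by a multiple of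
  \<open>norm x ^ k\<close>.\<close>

lemma euler_prod_has_sum:
  assumes "norm p < 1" "norm x < 1" and W: "(\<lambda>N. \<Prod>j<N. 1 + x * p ^ j) \<longlonglongrightarrow> W"
  shows "((\<lambda>k. p ^ (k choose 2) * x ^ k / qfact p k) has_sum W) UNIV"
proof -
  obtain C where C: "\<And>n k. norm (qbinomial p n k) \<le> C" "0 \<le> C"
    using qbinomial_bounded[OF assms(1)] by blast
  show ?thesis
  proof (rule tannery_has_sum[OF _ _ _ _ W])
    show "norm (p ^ (k choose 2) * qbinomial p n k * x ^ k) \<le> C * norm x ^ k" for k n
    proof -
      have "norm p ^ (k choose 2) * norm (qbinomial p n k) \<le> 1 * C"
        using assms C by (intro mult_mono power_le_one) auto
      then show ?thesis
        by (simp add: norm_mult norm_power mult_right_mono)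
    qed
    show "(\<lambda>k. C * norm x ^ k) summable_on UNIV"
      using assms(2) C(2) by (subst summable_on_UNIV_nonneg_real_iff) (simp_all add: summable_mult summable_geometric)
    show "(\<lambda>n. p ^ (k choose 2) * qbinomial p n k * x ^ k) \<longlonglongrightarrow> p ^ (k choose 2) * x ^ k / qfact p k" for k
    proof -
      have "(\<lambda>n. p ^ (k choose 2) * qbinomial p n k * x ^ k) \<longlonglongrightarrow> p ^ (k choose 2) * (1 / qfact p k) * x ^ k"
        by (intro tendsto_intros qbinomial_tendsto assms)
      then show ?thesis by simp
    qed
    show "((\<lambda>k. p ^ (k choose 2) * qbinomial p n k * x ^ k) has_sum (\<Prod>j<n. 1 + x * p ^ j)) UNIV" for n
      unfolding qbinomial_theorem[OF assms(1)]
      by (rule has_sum_finite_neutralI[of "{..n}"]) (simp_all add: qbinomial_def)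
  qed
qed

section \<open>The triple product for the theta series\<close>

lemma prod_lessThan_add:
  fixes h :: "nat \<Rightarrow> 'a::comm_monoid_mult"
  shows "(\<Prod>j<M + N. h j) = (\<Prod>j<M. h j) * (\<Prod>j<N. h (M + j))"
  by (induction N) (simp_all add: mult.assoc)

lemma prod_odd_powers:
  fixes u :: "'a::comm_monoid_mult"
  shows "(\<Prod>i<N. u ^ (2 * i + 1)) = u ^ N\<^sup>2"
proof -
  have "(\<Sum>i<N. 2 * i + 1) = N\<^sup>2"
    by (induction N) (simp_all add: power2_eq_square)
  then show ?thesis
    by (metis power_sum)
qed

lemma choose_2_double: "2 * (k choose 2) + k = k\<^sup>2"
  by (induction k) (simp_all add: numeral_2_eq_2)

text \<open>A finite form of the triple product. The q-binomial theorem is applied to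
  \<open>2 * N\<close> factors centred so that the first half, after reversal and multiplication by
  \<open>u ^ N\<^sup>2\<close>, coincides with the second half; hence the square.\<close>

lemma finite_theta_product:
  fixes u :: complex
  assumes "norm u < 1" "u \<noteq> 0"
  shows "(\<Sum>n = - int N..int N. u ^ nat (n\<^sup>2) * qbinomial (u\<^sup>2) (2 * N) (nat (n + int N))) =
    (\<Prod>j<N. 1 + u * (u\<^sup>2) ^ j)\<^sup>2"
proof -
  define p where "p = u\<^sup>2"
  \<comment> \<open>With this choice factor \<open>N + j\<close> is
    \<open>1 + u ^ (2 * j + 1)\<close>, and factor \<open>N - Suc i\<close> is 1 plus the inverse of
    \<open>u ^ (2 * i + 1)\<close>.\<close>
  define x where "x = u / p ^ N"
  have p: "norm p < 1" "p \<noteq> 0"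
    using assms by (simp_all add: p_def norm_power power_less_one_iff)
  have "(\<Sum>n = - int N..int N. u ^ nat (n\<^sup>2) * qbinomial p (2 * N) (nat (n + int N))) =
      (\<Sum>k\<le>2 * N. u ^ nat ((int k - int N)\<^sup>2) * qbinomial p (2 * N) k)"
    by (rule sum.reindex_bij_witness[of _ "\<lambda>k. int k - int N" "\<lambda>n. nat (n + int N)"]) auto
  also have "\<dots> = u ^ N\<^sup>2 * (\<Sum>k\<le>2 * N. p ^ (k choose 2) * qbinomial p (2 * N) k * x ^ k)"
    unfolding sum_distrib_left
  proof (rule sum.cong)
    fix k
    \<comment> \<open>Moving \<open>2 * N * k\<close> to the left keeps all exponents natural;
      negative powers of \<open>u\<close> then occur only as divisions.\<close>
    have "nat ((int k - int N)\<^sup>2) + 2 * N * k = k\<^sup>2 + N\<^sup>2"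
      using zero_le_power2[of "int k - int N"]
      by (intro int_int_eq[THEN iffD1]) (simp add: power2_eq_square algebra_simps)
    then have 1: "u ^ nat ((int k - int N)\<^sup>2) * u ^ (2 * N * k) = u ^ N\<^sup>2 * u ^ (2 * (k choose 2) + k)"
      by (simp only: choose_2_double flip: power_add) (simp add: add.commute)
    have "p ^ (k choose 2) * x ^ k = u ^ (2 * (k choose 2) + k) / u ^ (2 * N * k)"
      by (simp add: p_def x_def power_divide power_add flip: power_mult)
    moreover have "u ^ nat ((int k - int N)\<^sup>2) = u ^ N\<^sup>2 * u ^ (2 * (k choose 2) + k) / u ^ (2 * N * k)"
      using assms(2) by (simp only: 1[symmetric]) simp
    ultimately have "u ^ N\<^sup>2 * (p ^ (k choose 2) * x ^ k) = u ^ nat ((int k - int N)\<^sup>2)"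
      by (simp only: times_divide_eq_right)
    then show "u ^ nat ((int k - int N)\<^sup>2) * qbinomial p (2 * N) k =
        u ^ N\<^sup>2 * (p ^ (k choose 2) * qbinomial p (2 * N) k * x ^ k)"
      by (metis mult.assoc mult.commute)
  qed simp
  also have "(\<Sum>k\<le>2 * N. p ^ (k choose 2) * qbinomial p (2 * N) k * x ^ k) = (\<Prod>j<N + N. 1 + x * p ^ j)"
    unfolding qbinomial_theorem[OF p(1), symmetric] by (simp add: mult_2)
  also have "u ^ N\<^sup>2 * \<dots> =
      (u ^ N\<^sup>2 * (\<Prod>i<N. 1 + x * p ^ (N - Suc i))) * (\<Prod>j<N. 1 + x * p ^ (N + j))"
    unfolding prod_lessThan_add by (subst prod.nat_diff_reindex[symmetric]) simp
  \<comment> \<open>The prefactor is distributed as one odd power per factor, and each odd power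
    clears the denominator of its factor.\<close>
  also have "u ^ N\<^sup>2 * (\<Prod>i<N. 1 + x * p ^ (N - Suc i)) = (\<Prod>j<N. 1 + u * p ^ j)"
    unfolding prod_odd_powers[symmetric] prod.distrib[symmetric]
  proof (rule prod.cong)
    fix i
    assume "i \<in> {..<N}"
    then have "N - Suc i + Suc i = N"
      by simp
    then have "p ^ N = p ^ (N - Suc i) * p ^ Suc i"
      by (simp only: power_add[symmetric])
    then have "x * p ^ (N - Suc i) = u / p ^ Suc i"
      using p(2) by (simp add: x_def)
    moreover have "u ^ (2 * i + 1) * (u / p ^ Suc i) = 1"
      using assms(2) by (simp add: p_def power2_eq_square power_mult_distrib mult_2 power_add)
    ultimately have "u ^ (2 * i + 1) * (1 + x * p ^ (N - Suc i)) = u ^ (2 * i + 1) + 1"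
      by (simp only: distrib_left) simp
    then show "u ^ (2 * i + 1) * (1 + x * p ^ (N - Suc i)) = 1 + u * p ^ i"
      by (simp add: p_def flip: power_mult)
  qed simp
  also have "(\<Prod>j<N. 1 + x * p ^ (N + j)) = (\<Prod>j<N. 1 + u * p ^ j)"
    using p(2) by (simp add: x_def power_add)
  finally show ?thesis
    by (simp add: p_def power2_eq_square)
qed

lemma summable_on_int_power_square:
  fixes r :: real
  assumes "0 \<le> r" "r < 1"
  shows "(\<lambda>n::int. r ^ nat (n\<^sup>2)) summable_on UNIV"
proof -
  have "summable (\<lambda>n::nat. r ^ nat ((int n)\<^sup>2))"
  proof (rule summable_comparison_test)
    show "summable (\<lambda>n. r ^ n)"
      using assms by (simp add: summable_geometric)
    have "r ^ nat ((int n)\<^sup>2) \<le> r ^ n" for n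
      using assms by (intro power_decreasing) (auto simp: nat_power_eq power2_nat_le_imp_le)
    then show "\<exists>N. \<forall>n\<ge>N. norm (r ^ nat ((int n)\<^sup>2)) \<le> r ^ n"
      using assms by auto
  qed
  then have nat: "(\<lambda>n::nat. r ^ nat ((int n)\<^sup>2)) summable_on UNIV"
    using assms by (subst summable_on_UNIV_nonneg_real_iff) auto
  have "(\<lambda>n. r ^ nat (n\<^sup>2)) summable_on range int"
    using nat by (subst summable_on_reindex) (auto simp: o_def)
  moreover have "(\<lambda>n. r ^ nat (n\<^sup>2)) summable_on range (\<lambda>n. - int n)"
    using nat by (subst summable_on_reindex) (auto simp: o_def inj_def)
  ultimately have "(\<lambda>n. r ^ nat (n\<^sup>2)) summable_on (range int \<union> range (\<lambda>n. - int n))"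
    by (rule summable_on_union)
  moreover have "n \<in> range int \<union> range (\<lambda>n. - int n)" for n
    by (cases n rule: int_cases2) auto
  then have "range int \<union> range (\<lambda>n. - int n) = UNIV"
    by blast
  ultimately show ?thesis
    by simp
qed

text \<open>The limit of the finite product formula: each Gaussian binomial tends to
  \<open>Q / (Q * Q) = 1 / Q\<close>, and the terms are dominated by a multiple of
  \<open>norm u ^ nat (n\<^sup>2)\<close>.\<close>

lemma theta_triple_product:
  fixes u :: complex
  assumes "norm u < 1" "u \<noteq> 0"
    and W: "(\<lambda>N. \<Prod>j<N. 1 + u * (u\<^sup>2) ^ j) \<longlonglongrightarrow> W"
    and Q: "qfact (u\<^sup>2) \<longlonglongrightarrow> Q" "Q \<noteq> 0"
  shows "((\<lambda>n::int. u ^ nat (n\<^sup>2)) has_sum (W\<^sup>2 * Q)) UNIV"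
proof -
  let ?p = "u\<^sup>2"
  have p: "norm ?p < 1"
    using assms by (simp add: norm_power power_less_one_iff)
  obtain C where C: "\<And>n k. norm (qbinomial ?p n k) \<le> C" "0 \<le> C"
    using qbinomial_bounded[OF p] by blast
  \<comment> \<open>Extension by 0 outside \<open>{- int N..int N}\<close> gives all the sums the
    same index set.\<close>
  let ?f = "\<lambda>N (n::int). if \<bar>n\<bar> \<le> int N then u ^ nat (n\<^sup>2) * qbinomial ?p (2 * N) (nat (n + int N)) else 0"
  have "((\<lambda>n::int. u ^ nat (n\<^sup>2) * (1 / Q)) has_sum W\<^sup>2) UNIV"
  proof (rule tannery_has_sum)
    show "norm (?f N n) \<le> C * norm u ^ nat (n\<^sup>2)" for N n
    proof (cases "\<bar>n\<bar> \<le> int N")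
      case True
      have "norm u ^ nat (n\<^sup>2) * norm (qbinomial ?p (2 * N) (nat (n + int N))) \<le> norm u ^ nat (n\<^sup>2) * C"
        using C(1) by (intro mult_left_mono) auto
      then show ?thesis
        using True by (simp add: norm_mult norm_power mult.commute)
    qed (use C(2) in simp)
    show "(\<lambda>n::int. C * norm u ^ nat (n\<^sup>2)) summable_on UNIV"
      using assms by (intro summable_on_cmult_right summable_on_int_power_square) auto
    show "(?f N has_sum (\<Prod>j<N. 1 + u * ?p ^ j)\<^sup>2) UNIV" for N
      unfolding finite_theta_product[OF assms(1,2), symmetric]
      by (rule has_sum_finite_neutralI[of "{- int N..int N}"]) (auto intro!: sum.cong)
    show "(\<lambda>N. (\<Prod>j<N. 1 + u * ?p ^ j)\<^sup>2) \<longlonglongrightarrow> W\<^sup>2"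
      by (intro tendsto_intros W)
    fix n :: int
    have lim: "filterlim (\<lambda>N. nat (n + int N)) at_top sequentially" for n
      by (rule filterlim_at_top_mono[OF filterlim_minus_const_nat_at_top[of "nat \<bar>n\<bar>"]])
        (auto intro!: always_eventually)
    have lim2: "filterlim (\<lambda>N::nat. 2 * N) at_top sequentially"
      by (rule mult_nat_left_at_top) simp
    have "(\<lambda>N. qfact ?p (2 * N) / (qfact ?p (nat (n + int N)) * qfact ?p (nat (- n + int N)))) \<longlonglongrightarrow>
        Q / (Q * Q)"
      using Q(2) by (intro tendsto_intros filterlim_compose[OF Q(1)] lim lim2) auto
    moreover have "\<forall>\<^sub>F N in sequentially. qfact ?p (2 * N) / (qfact ?p (nat (n + int N)) * qfact ?p (nat (- n + int N)))
        = qbinomial ?p (2 * N) (nat (n + int N))"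
      using eventually_ge_at_top[of "nat \<bar>n\<bar>"]
    proof eventually_elim
      case (elim N)
      then have "2 * N - nat (n + int N) = nat (- n + int N)" "nat (n + int N) \<le> 2 * N"
        by auto
      then show ?case
        by (simp add: qbinomial_def)
    qed
    ultimately have "(\<lambda>N. qbinomial ?p (2 * N) (nat (n + int N))) \<longlonglongrightarrow> 1 / Q"
      using Q(2) by (simp add: filterlim_cong)
    then have "(\<lambda>N. u ^ nat (n\<^sup>2) * qbinomial ?p (2 * N) (nat (n + int N))) \<longlonglongrightarrow> u ^ nat (n\<^sup>2) * (1 / Q)"
      by (intro tendsto_intros)
    moreover have "\<forall>\<^sub>F N in sequentially. u ^ nat (n\<^sup>2) * qbinomial ?p (2 * N) (nat (n + int N)) = ?f N n"
      using eventually_ge_at_top[of "nat \<bar>n\<bar>"] by eventually_elim auto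
    ultimately show "(\<lambda>N. ?f N n) \<longlonglongrightarrow> u ^ nat (n\<^sup>2) * (1 / Q)"
      by (rule Lim_transform_eventually)
  qed
  from has_sum_cmult_left[OF this, of Q] show ?thesis
    using Q(2) by simp
qed

section \<open>The continued fraction\<close>

lemma fin_cfrac_nonneg:
  assumes "\<And>m. 0 \<le> a m" "\<And>m. 0 \<le> b m"
  shows "0 \<le> fin_cfrac a b n m"
  using assms by (induction n arbitrary: m) auto

text \<open>For \<open>0 \<le> a m \<le> 1\<close> and \<open>b m \<ge> 1\<close> the map
  \<open>t \<mapsto> a m / (b m + t)\<close> is 1-Lipschitz on nonnegative \<open>t\<close>.
  Truncation replaces the tail \<open>T (m + n)\<close> by 0, and this error does not grow on the
  way up.\<close>

lemma fin_cfrac_tail_error: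
  fixes a b T :: "nat \<Rightarrow> real"
  assumes a: "\<And>m. 0 \<le> a m" "\<And>m. a m \<le> 1" and b: "\<And>m. 1 \<le> b m"
    and T: "\<And>m. 0 \<le> T m" "\<And>m. T m = a m / (b m + T (Suc m))"
  shows "\<bar>fin_cfrac a b n m - T m\<bar> \<le> T (m + n)"
proof (induction n arbitrary: m)
  case 0
  then show ?case
    using T(1)[of m] by simp
next
  case (Suc n)
  let ?F = "fin_cfrac a b n (Suc m)"
  have F: "0 \<le> ?F"
    using a b by (intro fin_cfrac_nonneg) (auto intro: order_trans[OF zero_le_one])
  have p: "1 \<le> b m + ?F" "1 \<le> b m + T (Suc m)"
    using b[of m] F T(1)[of "Suc m"] by auto
  have "fin_cfrac a b (Suc n) m - T m = a m * (T (Suc m) - ?F) / ((b m + ?F) * (b m + T (Suc m)))"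
    using p by (subst T(2)) (simp add: field_simps)
  also have "\<bar>\<dots>\<bar> \<le> \<bar>T (Suc m) - ?F\<bar>"
  proof -
    have "1 * 1 \<le> (b m + ?F) * (b m + T (Suc m))"
      using p by (intro mult_mono) auto
    moreover have "a m * \<bar>T (Suc m) - ?F\<bar> \<le> 1 * \<bar>T (Suc m) - ?F\<bar>"
      using a by (intro mult_right_mono) auto
    ultimately have "a m * \<bar>T (Suc m) - ?F\<bar> / ((b m + ?F) * (b m + T (Suc m))) \<le> \<bar>T (Suc m) - ?F\<bar> / 1"
      by (intro frac_le) auto
    then show ?thesis
      using a(1)[of m] p by (simp add: abs_mult)
  qed
  also have "\<dots> \<le> T (Suc m + n)"
    using Suc.IH[of "Suc m"] by (simp add: abs_minus_commute)
  finally show ?case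
    by simp
qed

text \<open>Convergence need not be known beforehand: a nonnegative solution of the tail equation
  that tends to 0 forces it.\<close>

lemma inf_cfrac_eqI:
  fixes a b T :: "nat \<Rightarrow> real"
  assumes a: "\<And>m. 0 \<le> a m" "\<And>m. a m \<le> 1" and b: "\<And>m. 1 \<le> b m"
    and T: "\<And>m. 0 \<le> T m" "\<And>m. T m = a m / (b m + T (Suc m))" "T \<longlonglongrightarrow> 0"
  shows "inf_cfrac a b = T 0"
proof -
  have "(\<lambda>n. fin_cfrac a b n 0 - T 0) \<longlonglongrightarrow> 0"
    using fin_cfrac_tail_error[where a = a and b = b and T = T, OF a b T(1,2), of _ 0]
    by (intro Lim_null_comparison[OF _ T(3)]) simp
  then have "(\<lambda>n. fin_cfrac a b n 0) \<longlonglongrightarrow> T 0"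
    by (simp add: LIM_zero_iff)
  then show ?thesis
    by (simp add: inf_cfrac_def limI)
qed

text \<open>For \<open>m = 0, 1\<close> these are the terms of even and odd index in Euler's expansion of
  \<open>\<Prod>(1 + u (u\<^sup>2)\<^sup>j)\<close>, \<open>u = i \<surd>q\<close>; larger \<open>m\<close> continue them to a solution of the recurrence behind
  the continued fraction.\<close>

definition gg_term :: "real \<Rightarrow> nat \<Rightarrow> nat \<Rightarrow> real" where
  "gg_term q m n = q ^ (2 * n\<^sup>2 + 2 * n * m) /
     ((\<Prod>j<n + m. 1 + q ^ (2 * j + 1)) * (\<Prod>j<n. 1 - q ^ (2 * j + 2)))"

definition gg_sum :: "real \<Rightarrow> nat \<Rightarrow> real" where
  "gg_sum q m = (\<Sum>n. gg_term q m n)"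

context
  fixes q :: real
  assumes q: "0 < q" "q < 1"
begin

lemma one_minus_even_power_pos: "0 < 1 - q ^ (2 * j + 2)"
  using q power_less_one_iff[of q "2 * j + 2"] by simp

lemma one_plus_odd_power_ge: "1 \<le> 1 + q ^ (2 * j + 1)"
  using q by simp

lemma gg_term_pos: "0 < gg_term q m n"
  unfolding gg_term_def
  using q one_plus_odd_power_ge one_minus_even_power_pos
  by (intro divide_pos_pos mult_pos_pos prod_pos) (auto intro: less_le_trans[OF zero_less_one])

text \<open>The factors \<open>1 - q ^ (2 * j + 2)\<close> form \<open>qfact\<close> at base
  \<open>q\<^sup>2\<close>, whose inverse is bounded by some \<open>M\<close>. The other product is
  at least 1, which leaves the majorant \<open>M * q ^ n\<close>.\<close>

lemma summable_gg_term: "summable (gg_term q m)"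
proof -
  have p: "norm (complex_of_real (q\<^sup>2)) < 1"
    using q by (simp add: norm_power power_less_one_iff)
  obtain Q where Q: "qfact (of_real (q\<^sup>2)) \<longlonglongrightarrow> Q" "Q \<noteq> 0"
    using qfact_tendsto[OF p] .
  obtain M where M: "0 < M" "\<And>n. norm (inverse (qfact (of_real (q\<^sup>2)) n)) \<le> M"
    using convergent_imp_Bseq[OF convergentI[OF tendsto_inverse[OF Q]]] by (auto simp: Bseq_def)
  show ?thesis
  proof (rule summable_comparison_test)
    show "summable (\<lambda>n. M * q ^ n)"
      using q by (intro summable_mult summable_geometric) auto
    have "gg_term q m n \<le> M * q ^ n" for n
    proof -
      have "qfact (of_real (q\<^sup>2)) n = of_real (\<Prod>j<n. 1 - q ^ (2 * j + 2))"
      proof -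
        have "complex_of_real (q\<^sup>2) ^ Suc j = of_real (q ^ (2 * j + 2))" for j
          by (metis add.commute mult_Suc_right of_real_power power_mult)
        then show ?thesis
          by (simp only: qfact_def of_real_prod of_real_diff of_real_1)
      qed
      moreover have pos: "0 < (\<Prod>j<n. 1 - q ^ (2 * j + 2))"
        using one_minus_even_power_pos by (intro prod_pos) auto
      ultimately have "norm (inverse (qfact (of_real (q\<^sup>2)) n)) = 1 / (\<Prod>j<n. 1 - q ^ (2 * j + 2))"
        by (simp only: norm_inverse norm_of_real abs_of_pos divide_inverse mult_1)
      then have "1 / (\<Prod>j<n. 1 - q ^ (2 * j + 2)) \<le> M"
        using M(2)[of n] by simp
      moreover have "1 \<le> (\<Prod>j<n + m. 1 + q ^ (2 * j + 1))"
        using one_plus_odd_power_ge by (intro prod_ge_1)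
      moreover note pos
      moreover have "q ^ (2 * n\<^sup>2 + 2 * n * m) \<le> q ^ n"
      proof (rule power_decreasing)
        have "n * n \<le> 2 * n\<^sup>2 + 2 * n * m"
          by (simp add: power2_eq_square)
        then show "n \<le> 2 * n\<^sup>2 + 2 * n * m"
          using le_square order_trans by blast
      qed (use q in auto)
      ultimately have "q ^ (2 * n\<^sup>2 + 2 * n * m) / (\<Prod>j<n + m. 1 + q ^ (2 * j + 1)) *
          (1 / (\<Prod>j<n. 1 - q ^ (2 * j + 2))) \<le> q ^ n / 1 * M"
        using q M by (intro mult_mono frac_le) auto
      then show ?thesis
        by (simp add: gg_term_def mult.commute)
    qed
    then show "\<exists>N. \<forall>n\<ge>N. norm (gg_term q m n) \<le> M * q ^ n"
      using gg_term_pos[of m] by (auto simp: abs_of_pos)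
  qed
qed

lemma gg_sum_pos: "0 < gg_sum q m"
  unfolding gg_sum_def by (intro suminf_pos summable_gg_term gg_term_pos)

lemma gg_term_0: "gg_term q m 0 = (1 + q ^ (2 * m + 1)) * gg_term q (Suc m) 0"
  using one_plus_odd_power_ge[of m] by (simp add: gg_term_def)

text \<open>Over a common denominator everything reduces to \<open>(1 + q ^ (2 * m + 1)) * q ^ (2 *
  n + 2) + (1 - q ^ (2 * n + 2)) = 1 + q ^ (2 * Suc (n + m) + 1)\<close>. The index shift
  \<open>Suc n\<close> against \<open>n\<close> lets these identities sum up to the three-term
  recurrence.\<close>

lemma gg_term_Suc:
  "gg_term q m (Suc n) =
    (1 + q ^ (2 * m + 1)) * gg_term q (Suc m) (Suc n) + q ^ (2 * m + 2) * gg_term q (Suc (Suc m)) n"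
proof -
  define A where "A = (\<Prod>j<n + m. 1 + q ^ (2 * j + 1))"
  define B where "B = (\<Prod>j<n. 1 - q ^ (2 * j + 2))"
  define x where "x = 1 + q ^ (2 * (n + m) + 1)"
  define y where "y = 1 + q ^ (2 * Suc (n + m) + 1)"
  define z where "z = 1 - q ^ (2 * n + 2)"
  define e where "e = q ^ (2 * (Suc n)\<^sup>2 + 2 * Suc n * m)"
  have "0 < A" "0 < B" "0 < x" "0 < y" "0 < z"
    unfolding A_def B_def x_def y_def z_def using q one_minus_even_power_pos
    by (auto intro!: prod_pos add_pos_pos)
  then have nz: "A \<noteq> 0" "B \<noteq> 0" "x \<noteq> 0" "y \<noteq> 0" "z \<noteq> 0"
    by auto
  have prods: "(\<Prod>j<Suc n + m. 1 + q ^ (2 * j + 1)) = A * x"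
    "(\<Prod>j<Suc n + Suc m. 1 + q ^ (2 * j + 1)) = A * x * y"
    "(\<Prod>j<n + Suc (Suc m). 1 + q ^ (2 * j + 1)) = A * x * y"
    "(\<Prod>j<Suc n. 1 - q ^ (2 * j + 2)) = B * z"
    "(\<Prod>j<n. 1 - q ^ (2 * j + 2)) = B"
    unfolding A_def B_def x_def y_def z_def by (simp_all only: add_Suc add_Suc_right prod.lessThan_Suc)
  have 1: "gg_term q m (Suc n) = e / (A * x * (B * z))"
    by (simp only: gg_term_def prods e_def)
  have "q ^ (2 * (Suc n)\<^sup>2 + 2 * Suc n * Suc m) = e * q ^ (2 * n + 2)"
    unfolding e_def power_add[symmetric]
    by (rule arg_cong[where f = "power q"]) (simp add: algebra_simps)
  then have 2: "gg_term q (Suc m) (Suc n) = e * q ^ (2 * n + 2) / (A * x * y * (B * z))"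
    by (simp only: gg_term_def prods)
  have "q ^ (2 * m + 2) * q ^ (2 * n\<^sup>2 + 2 * n * Suc (Suc m)) = e"
    unfolding e_def power_add[symmetric]
    by (rule arg_cong[where f = "power q"]) (simp add: power2_eq_square algebra_simps)
  then have 3: "q ^ (2 * m + 2) * gg_term q (Suc (Suc m)) n = e / (A * x * y * B)"
    by (simp only: gg_term_def prods times_divide_eq_right)
  have "q ^ (2 * m + 1) * q ^ (2 * n + 2) = q ^ (2 * Suc (n + m) + 1)"
    unfolding power_add[symmetric] by (rule arg_cong[where f = "power q"]) simp
  then have y: "(1 + q ^ (2 * m + 1)) * q ^ (2 * n + 2) + z = y"
    unfolding y_def z_def by (simp add: distrib_right)
  have arith: "e / (A * x * (B * z)) = c * (e * w / (A * x * y * (B * z))) + e / (A * x * y * B)"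
    if "c * w + z = y" for c w
  proof -
    have "c * (e * w / (A * x * y * (B * z))) + e / (A * x * y * B) = e * (c * w + z) / (A * x * y * (B * z))"
      using nz by (simp add: divide_simps) (simp add: algebra_simps)
    then show ?thesis
      using nz that by simp
  qed
  show ?thesis
    unfolding 1 2 3 by (rule arith[OF y])
qed

lemma gg_sum_recurrence:
  "gg_sum q m = (1 + q ^ (2 * m + 1)) * gg_sum q (Suc m) + q ^ (2 * m + 2) * gg_sum q (Suc (Suc m))"
proof -
  let ?c = "1 + q ^ (2 * m + 1)" and ?d = "q ^ (2 * m + 2)"
  have S: "gg_term q k sums gg_sum q k" for k
    unfolding gg_sum_def by (rule summable_sums[OF summable_gg_term])
  have "(\<lambda>n. gg_term q (Suc m) (Suc n)) sums (gg_sum q (Suc m) - gg_term q (Suc m) 0)"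
    using S[of "Suc m"] by (subst sums_Suc_iff) simp
  then have "(\<lambda>n. ?c * gg_term q (Suc m) (Suc n) + ?d * gg_term q (Suc (Suc m)) n) sums
      (?c * (gg_sum q (Suc m) - gg_term q (Suc m) 0) + ?d * gg_sum q (Suc (Suc m)))"
    by (intro sums_add sums_mult S)
  then have "(\<lambda>n. gg_term q m (Suc n)) sums
      (?c * (gg_sum q (Suc m) - gg_term q (Suc m) 0) + ?d * gg_sum q (Suc (Suc m)))"
    by (simp only: gg_term_Suc[of m])
  then have "gg_term q m sums
      (?c * (gg_sum q (Suc m) - gg_term q (Suc m) 0) + ?d * gg_sum q (Suc (Suc m)) + gg_term q m 0)"
    by (subst (asm) sums_Suc_iff)
  then have "gg_sum q m = ?c * (gg_sum q (Suc m) - gg_term q (Suc m) 0) + ?d * gg_sum q (Suc (Suc m)) + gg_term q m 0"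
    using S sums_unique2 by blast
  then show ?thesis
    by (simp add: gg_term_0[of m] algebra_simps)
qed

text \<open>The recurrence, divided by \<open>gg_sum q (Suc m)\<close>, says that the ratios
  \<open>?T\<close> solve the tail equation. They tend to 0 because \<open>?T m\<close> is at most
  the partial numerator \<open>?a m\<close>. The exceptional numerator \<open>sqrt q\<close> at
  index 0 is the factor in front.\<close>

lemma rgg_eq_gg_sum: "rgg q = sqrt q * gg_sum q 1 / gg_sum q 0"
proof -
  let ?a = "\<lambda>n. if n = 0 then sqrt q else q ^ (2 * n)" and ?b = "\<lambda>n. 1 + q ^ (2 * n + 1)"
  let ?T = "\<lambda>m. ?a m * gg_sum q (Suc m) / gg_sum q m"
  have rec: "?T m = ?a m / (?b m + ?T (Suc m))" for m
  proof -
    have "?b m + ?T (Suc m) = gg_sum q m / gg_sum q (Suc m)"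
      using gg_sum_pos[of "Suc m"] by (subst gg_sum_recurrence[of m]) (simp add: field_simps)
    then show ?thesis
      using gg_sum_pos[of "Suc m"] by simp
  qed
  have a: "0 \<le> ?a m" "?a m \<le> 1" for m
    using q by (auto intro!: power_le_one)
  have T: "0 \<le> ?T m" for m
    using gg_sum_pos[of m] gg_sum_pos[of "Suc m"] a[of m] by (intro divide_nonneg_pos mult_nonneg_nonneg) auto
  have "?T \<longlonglongrightarrow> 0"
  proof (rule Lim_null_comparison)
    have "(\<lambda>n. (q\<^sup>2) ^ n) \<longlonglongrightarrow> 0"
      using q by (intro LIMSEQ_power_zero) (simp add: power_less_one_iff)
    then show "(\<lambda>n. q ^ (2 * n)) \<longlonglongrightarrow> 0"
      by (simp add: power_mult)
    have "?T m \<le> ?a m" for m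
    proof -
      have "1 \<le> ?b m + ?T (Suc m)"
        using one_plus_odd_power_ge[of m] T[of "Suc m"] by linarith
      then have "?a m / (?b m + ?T (Suc m)) \<le> ?a m / 1"
        using a(1) by (intro divide_left_mono) auto
      then show ?thesis
        by (simp only: rec[of m])
    qed
    then have *: "norm (?T m) \<le> q ^ (2 * m)" if "0 < m" for m
      using T[of m] that by (metis abs_of_nonneg not_gr_zero real_norm_def)
    show "\<forall>\<^sub>F m in sequentially. norm (?T m) \<le> q ^ (2 * m)"
      by (rule eventually_mono[OF eventually_gt_at_top[of 0] *])
  qed
  then have "inf_cfrac ?a ?b = ?T 0"
    by (intro inf_cfrac_eqI[where T = ?T] a T rec one_plus_odd_power_ge)
  then show ?thesis
    by (simp add: rgg_def)
qed

section \<open>The Euler product as real and imaginary part\<close>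

text \<open>At base \<open>- q\<close> the odd exponents give plus signs and the even ones minus
  signs, which are the two products in the denominator of \<open>gg_term\<close>.\<close>

lemma qfact_uminus_even:
  "qfact (- of_real q) (2 * n) =
    of_real ((\<Prod>j<n. 1 + q ^ (2 * j + 1)) * (\<Prod>j<n. 1 - q ^ (2 * j + 2)))"
proof (induction n)
  case (Suc n)
  let ?A = "\<Prod>j<n. 1 + q ^ (2 * j + 1)" and ?B = "\<Prod>j<n. 1 - q ^ (2 * j + 2)"
  have "1 - (- complex_of_real q) ^ Suc (2 * n) = of_real (1 + q ^ (2 * n + 1))"
    "1 - (- complex_of_real q) ^ Suc (Suc (2 * n)) = of_real (1 - q ^ (2 * n + 2))"
    by simp_all
  then have "qfact (- of_real q) (Suc (Suc (2 * n))) =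
      of_real (?A * ?B) * of_real (1 + q ^ (2 * n + 1)) * of_real (1 - q ^ (2 * n + 2))"
    by (simp only: qfact_Suc Suc)
  also have "\<dots> = of_real ((?A * (1 + q ^ (2 * n + 1))) * (?B * (1 - q ^ (2 * n + 2))))"
    by (simp only: of_real_mult[symmetric] mult.assoc mult.left_commute)
  finally show ?case
    by (simp only: prod.lessThan_Suc mult_Suc_right add_2_eq_Suc)
qed simp

lemma euler_prod_eq_gg_sum:
  fixes W :: complex
  defines "u \<equiv> \<i> * of_real (sqrt q)"
  assumes W: "(\<lambda>N. \<Prod>j<N. 1 + u * (u\<^sup>2) ^ j) \<longlonglongrightarrow> W"
  shows "W = of_real (gg_sum q 0) + u * of_real (gg_sum q 1)"
proof -
  have p: "u\<^sup>2 = - of_real q"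
    using q by (simp add: u_def power_mult_distrib flip: of_real_power)
  have norm: "norm u < 1" "norm (u\<^sup>2) < 1"
    using q by (simp_all add: p) (simp add: u_def norm_mult)
  let ?t = "\<lambda>k. (u\<^sup>2) ^ (k choose 2) * u ^ k / qfact (u\<^sup>2) k"
  have gg: "(gg_term q m has_sum gg_sum q m) UNIV" for m
    unfolding gg_sum_def using summable_gg_term[of m] gg_term_pos[of m]
    by (intro norm_summable_imp_has_sum summable_sums) (auto simp: abs_of_pos)
  \<comment> \<open>All exponents of \<open>u\<^sup>2 = - q\<close> that arise below,
    \<open>2 * n\<^sup>2\<close> and \<open>2 * (n\<^sup>2 + n)\<close>, are even, so no sign
    survives.\<close>
  have even_exp: "(u\<^sup>2) ^ (2 * k) = of_real (q ^ (2 * k))" for k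
    by (simp add: p)
  have even: "?t (2 * n) = of_real (gg_term q 0 n)" for n
  proof -
    have "(2 * n choose 2) + n = 2 * n\<^sup>2"
      using choose_2_double[of "2 * n"] by (simp add: power2_eq_square)
    then have "(u\<^sup>2) ^ (2 * n choose 2) * u ^ (2 * n) = of_real (q ^ (2 * n\<^sup>2))"
      unfolding power_mult[of u] power_add[symmetric] by (simp only: even_exp)
    then show ?thesis
      by (simp add: p qfact_uminus_even gg_term_def)
  qed
  have odd: "?t (2 * n + 1) = u * of_real (gg_term q 1 n)" for n
  proof -
    have "(2 * n + 1 choose 2) + n = 2 * (n\<^sup>2 + n)"
      using choose_2_double[of "2 * n + 1"] by (simp add: power2_eq_square algebra_simps)
    moreover have "(u\<^sup>2) ^ c * u ^ (2 * n + 1) = u * (u\<^sup>2) ^ (c + n)" for c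
      by (simp add: power_add power_mult)
    ultimately have "(u\<^sup>2) ^ (2 * n + 1 choose 2) * u ^ (2 * n + 1) = u * of_real (q ^ (2 * (n\<^sup>2 + n)))"
      by (simp only: even_exp)
    moreover have "qfact (u\<^sup>2) (2 * n + 1) =
        of_real ((\<Prod>j<n + 1. 1 + q ^ (2 * j + 1)) * (\<Prod>j<n. 1 - q ^ (2 * j + 2)))"
    proof -
      have "1 - (- complex_of_real q) ^ Suc (2 * n) = of_real (1 + q ^ (2 * n + 1))"
        by simp
      then have "qfact (u\<^sup>2) (2 * n + 1) =
          of_real ((\<Prod>j<n. 1 + q ^ (2 * j + 1)) * (\<Prod>j<n. 1 - q ^ (2 * j + 2))) * of_real (1 + q ^ (2 * n + 1))"
        unfolding p qfact_uminus_even[symmetric] by (simp only: Suc_eq_plus1[symmetric] qfact_Suc)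
      then show ?thesis
        unfolding of_real_mult[symmetric] by (simp add: mult_ac)
    qed
    ultimately show ?thesis
      by (simp add: gg_term_def distrib_left)
  qed
  have "(?t has_sum of_real (gg_sum q 0)) (range (\<lambda>n. 2 * n))"
    using has_sum_of_real[OF gg[of 0], where 'a = complex]
    by (subst has_sum_reindex) (auto simp: inj_def o_def even)
  moreover have "(?t has_sum u * of_real (gg_sum q 1)) (range (\<lambda>n. 2 * n + 1))"
    using has_sum_cmult_right[OF has_sum_of_real[OF gg[of 1], where 'a = complex], of u]
    by (subst has_sum_reindex) (auto simp: inj_def o_def odd simp del: One_nat_def)
  moreover have "2 * m \<noteq> 2 * n + 1" for m n :: nat
    by presburger
  then have "range (\<lambda>n::nat. 2 * n) \<inter> range (\<lambda>n. 2 * n + 1) = {}"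
    by blast
  ultimately have "(?t has_sum (of_real (gg_sum q 0) + u * of_real (gg_sum q 1)))
      (range (\<lambda>n. 2 * n) \<union> range (\<lambda>n. 2 * n + 1))"
    by (rule has_sum_Un_disjoint)
  moreover have "n \<in> range (\<lambda>n. 2 * n) \<union> range (\<lambda>n. 2 * n + 1)" for n :: nat
    by (cases "even n") (blast elim: evenE oddE)+
  then have "range (\<lambda>n::nat. 2 * n) \<union> range (\<lambda>n. 2 * n + 1) = UNIV"
    by blast
  ultimately have "(?t has_sum (of_real (gg_sum q 0) + u * of_real (gg_sum q 1))) UNIV"
    by simp
  then show ?thesis
    by (rule has_sum_unique[OF euler_prod_has_sum[OF norm(2,1) W]])
qed

end

section \<open>Theta series\<close>

text \<open>In Jacobi's notation \<open>theta_sq q = \<theta>\<^sub>3(q)\<close> and \<open>theta_pr q = q\<^bsup>-1/4\<^esup> \<theta>\<^sub>2(q)\<close>.\<close>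

definition theta_sq :: "real \<Rightarrow> real" where
  "theta_sq q = (\<Sum>\<^sub>\<infinity>n::int. q ^ nat (n\<^sup>2))"

definition theta_pr :: "real \<Rightarrow> real" where
  "theta_pr q = (\<Sum>\<^sub>\<infinity>n::int. q ^ nat (n\<^sup>2 + n))"

lemma int_square_add_self_nonneg: "0 \<le> (n::int)\<^sup>2 + n"
proof -
  have "0 \<le> n * (n + 1)"
    by (cases "0 \<le> n") (auto intro: mult_nonneg_nonneg mult_nonpos_nonpos)
  then show ?thesis
    by (simp add: power2_eq_square algebra_simps)
qed

lemma power_nat_mult:
  assumes "0 \<le> x" "0 \<le> y"
  shows "(p::'a::monoid_mult) ^ nat x * p ^ nat y = p ^ nat (x + y)"
  using assms by (simp add: nat_add_distrib power_add)

lemma power_power_nat: "0 \<le> x \<Longrightarrow> ((p::'a::monoid_mult) ^ k) ^ nat x = p ^ nat (int k * x)"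
  by (simp add: nat_mult_distrib flip: power_mult)

lemma has_sum_times_nonneg:
  fixes f :: "'a \<Rightarrow> real" and g :: "'b \<Rightarrow> real"
  assumes f: "(f has_sum A) UNIV" "\<And>x. 0 \<le> f x" and g: "(g has_sum B) UNIV" "\<And>y. 0 \<le> g y"
  shows "((\<lambda>z. f (fst z) * g (snd z)) has_sum (A * B)) UNIV"
proof -
  let ?h = "\<lambda>z. f (fst z) * g (snd z)"
  have inner: "((\<lambda>y. ?h (x, y)) has_sum (f x * B)) UNIV" for x
    using has_sum_cmult_right[OF g(1), of "f x"] by simp
  have outer: "((\<lambda>x. f x * B) has_sum (A * B)) UNIV"
    by (rule has_sum_cmult_left[OF f(1)])
  have "?h summable_on Sigma UNIV (\<lambda>_. UNIV)"
    by (rule summable_on_SigmaI[OF inner has_sum_imp_summable[OF outer]]) (simp add: f g)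
  then have "(?h has_sum (A * B)) (Sigma UNIV (\<lambda>_. UNIV))"
    by (rule has_sum_SigmaI[OF inner outer])
  then show ?thesis
    by simp
qed

text \<open>The lattice \<open>\<int>\<^sup>2\<close> splits by the parity of \<open>m + n\<close>; both cosets are images of \<open>\<int>\<^sup>2\<close> under
  \<open>(i, j) \<mapsto> (i + j, i - j)\<close>, up to translation.\<close>

lemma has_sum_int_parity:
  fixes F :: "int \<times> int \<Rightarrow> real" and c :: int
  assumes c: "odd c"
    and even: "((\<lambda>z. F (fst z + snd z, fst z - snd z)) has_sum A) UNIV"
    and odd: "((\<lambda>z. F (fst z + snd z, fst z - snd z + c)) has_sum B) UNIV"
  shows "(F has_sum (A + B)) UNIV"
proof -
  let ?e = "\<lambda>z::int \<times> int. (fst z + snd z, fst z - snd z)"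
    and ?o = "\<lambda>z::int \<times> int. (fst z + snd z, fst z - snd z + c)"
  have "inj ?e" "inj ?o"
    by (auto simp: inj_def)
  then have "(F has_sum A) (range ?e)" "(F has_sum B) (range ?o)"
    using even odd by (simp_all add: has_sum_reindex o_def)
  moreover have "range ?e = {z. even (fst z + snd z)}"
  proof safe
    fix m n :: int
    assume "even (fst (m, n) + snd (m, n))"
    then have "(m, n) = ?e ((m + n) div 2, (m - n) div 2)"
      by simp presburger
    then show "(m, n) \<in> range ?e"
      by blast
  qed auto
  moreover have "range ?o = {z. odd (fst z + snd z)}"
  proof safe
    fix m n :: int
    assume "odd (fst (m, n) + snd (m, n))"
    then have "even (m + (n - c))" "even (m - (n - c))"
      using c by auto
    then have "(m, n) = ?o ((m + (n - c)) div 2, (m - (n - c)) div 2)"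
      by simp presburger
    then show "(m, n) \<in> range ?o"
      by blast
  qed (use c in auto)
  moreover have "{z::int \<times> int. even (fst z + snd z)} \<inter> {z. odd (fst z + snd z)} = {}"
    by blast
  ultimately have "(F has_sum (A + B)) ({z. even (fst z + snd z)} \<union> {z. odd (fst z + snd z)})"
    by (simp only: has_sum_Un_disjoint)
  moreover have "{z::int \<times> int. even (fst z + snd z)} \<union> {z. odd (fst z + snd z)} = UNIV"
    by blast
  ultimately show ?thesis
    by simp
qed

section \<open>Summability and elementary bounds of the theta series\<close>

context
  fixes q :: real
  assumes q: "0 < q" "q < 1"
begin

lemma theta_sq_has_sum: "((\<lambda>n::int. q ^ nat (n\<^sup>2)) has_sum theta_sq q) UNIV"
  unfolding theta_sq_def using q by (intro has_sum_infsum summable_on_int_power_square) auto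

lemma theta_sq_shift_has_sum: "((\<lambda>n::int. q ^ nat ((n + 1)\<^sup>2)) has_sum theta_sq q) UNIV"
proof -
  have "bij_betw (\<lambda>n::int. n + 1) UNIV UNIV"
    by (rule bij_betwI[of _ _ _ "\<lambda>n. n - 1"]) auto
  from has_sum_reindex_bij_betw[OF this, of "\<lambda>n. q ^ nat (n\<^sup>2)" "theta_sq q"] show ?thesis
    using theta_sq_has_sum by (rule iffD2)
qed

text \<open>The exponent \<open>n\<^sup>2 + n\<close> is at least \<open>n\<^sup>2\<close> for
  \<open>n \<ge> 0\<close> and at least \<open>(n + 1)\<^sup>2\<close> for \<open>n < 0\<close>.
  This yields both summability and the bound \<open>theta_pr_le\<close>.\<close>

lemma theta_pr_term_le: "q ^ nat (n\<^sup>2 + n) \<le> q ^ nat (n\<^sup>2) + q ^ nat ((n + 1)\<^sup>2)"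
proof (cases "0 \<le> n")
  case True
  then have "q ^ nat (n\<^sup>2 + n) \<le> q ^ nat (n\<^sup>2)"
    using q by (intro power_decreasing) auto
  then show ?thesis
    using q by (simp add: add_increasing2)
next
  case False
  then have "q ^ nat (n\<^sup>2 + n) \<le> q ^ nat ((n + 1)\<^sup>2)"
    using q by (intro power_decreasing nat_mono) (auto simp: power2_eq_square algebra_simps)
  then show ?thesis
    using q by (simp add: add_increasing)
qed

lemma theta_pr_has_sum: "((\<lambda>n::int. q ^ nat (n\<^sup>2 + n)) has_sum theta_pr q) UNIV"
  unfolding theta_pr_def
proof (rule has_sum_infsum, rule summable_on_comparison_test)
  show "(\<lambda>n. q ^ nat (n\<^sup>2) + q ^ nat ((n + 1)\<^sup>2)) summable_on UNIV"
    by (rule has_sum_imp_summable[OF has_sum_add[OF theta_sq_has_sum theta_sq_shift_has_sum]])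
qed (use q theta_pr_term_le in auto)

lemma theta_pr_le: "theta_pr q \<le> 2 * theta_sq q"
  using has_sum_mono[OF theta_pr_has_sum has_sum_add[OF theta_sq_has_sum theta_sq_shift_has_sum]]
    theta_pr_term_le by simp

lemma theta_sq_ge_1: "1 \<le> theta_sq q"
  using finite_sum_le_has_sum[OF theta_sq_has_sum, of "{0}"] q by simp

lemma theta_pr_ge_1: "1 \<le> theta_pr q"
  using finite_sum_le_has_sum[OF theta_pr_has_sum, of "{0}"] q by simp

lemma theta_sq_mono:
  assumes "0 < p" "p \<le> q"
  shows "theta_sq p \<le> theta_sq q"
proof (rule has_sum_mono[OF _ theta_sq_has_sum])
  show "((\<lambda>n::int. p ^ nat (n\<^sup>2)) has_sum theta_sq p) UNIV"
    unfolding theta_sq_def using assms q by (intro has_sum_infsum summable_on_int_power_square) auto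
qed (use assms in \<open>auto intro: power_mono\<close>)

end

section \<open>Duplication formulas and the parity splitting of the theta series\<close>

text \<open>Each square is a double series over pairs of integers, split by parity; in the
  coordinates \<open>i + j\<close>, \<open>i - j\<close> the mixed terms cancel and each part
  factors into series at \<open>q\<^sup>2\<close>.\<close>

lemma theta_double:
  fixes q :: real
  assumes q: "0 < q" "q < 1"
  shows "(theta_sq q)\<^sup>2 = (theta_sq (q\<^sup>2))\<^sup>2 + q * (theta_pr (q\<^sup>2))\<^sup>2"
    and "(theta_pr q)\<^sup>2 = 2 * theta_sq (q\<^sup>2) * theta_pr (q\<^sup>2)"
proof -
  have q2: "0 < q\<^sup>2" "q\<^sup>2 < 1"
    using q by (simp_all add: power_less_one_iff)
  let ?a = "\<lambda>p n. p ^ nat (n\<^sup>2) :: real" and ?b = "\<lambda>p n. p ^ nat (n\<^sup>2 + n) :: real"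
  have comb: "q ^ nat x * q ^ nat y = (q\<^sup>2) ^ nat z * (q\<^sup>2) ^ nat w"
    if "x + y = 2 * z + 2 * w" "0 \<le> x" "0 \<le> y" "0 \<le> z" "0 \<le> w" for x y z w
    using that by (simp add: power_nat_mult power_power_nat)
  have comb': "q ^ nat x * q ^ nat y = q * ((q\<^sup>2) ^ nat z * (q\<^sup>2) ^ nat w)"
    if "x + y = 2 * z + 2 * w + 1" "0 \<le> x" "0 \<le> y" "0 \<le> z" "0 \<le> w" for x y z w
  proof -
    have "q * ((q\<^sup>2) ^ nat z * (q\<^sup>2) ^ nat w) = q ^ nat (2 * z + 2 * w) * q ^ nat 1"
      using that by (simp add: power_nat_mult power_power_nat)
    also have "\<dots> = q ^ nat x * q ^ nat y"
      using that by (simp only: power_nat_mult)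
    finally show ?thesis by simp
  qed
  note sums = theta_sq_has_sum[OF q2] theta_pr_has_sum[OF q2]
  have 1: "((\<lambda>z. ?a q (fst z) * ?a q (snd z)) has_sum
      (theta_sq (q\<^sup>2) * theta_sq (q\<^sup>2) + q * (theta_pr (q\<^sup>2) * theta_pr (q\<^sup>2)))) UNIV"
  \<comment> \<open>On the odd coset the exponent is
    \<open>2 * (i\<^sup>2 - i) + 2 * (j\<^sup>2 + j) + 1\<close>; the reflection of \<open>i\<close>
    brings the first term into the form of \<open>theta_pr\<close>, and the final 1 is the factor
    \<open>q\<close>.\<close>
  proof (rule has_sum_int_parity[where c = "- 1"])
    have "?a q (i + j) * ?a q (i - j) = ?a (q\<^sup>2) i * ?a (q\<^sup>2) j" for i j :: int
      by (rule comb, simp add: power2_eq_square algebra_simps)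
        (rule zero_le_power2 int_square_add_self_nonneg)+
    then show "((\<lambda>z. ?a q (fst (fst z + snd z, fst z - snd z)) * ?a q (snd (fst z + snd z, fst z - snd z)))
        has_sum theta_sq (q\<^sup>2) * theta_sq (q\<^sup>2)) UNIV"
      using has_sum_times_nonneg[OF sums(1) _ sums(1)] q by simp
    have "?a q (i + j) * ?a q (i - j + - 1) = q * (?b (q\<^sup>2) (- i) * ?b (q\<^sup>2) j)" for i j :: int
      by (rule comb', simp add: power2_eq_square algebra_simps)
        (rule zero_le_power2 int_square_add_self_nonneg)+
    moreover have "bij_betw (\<lambda>n::int. - n) UNIV UNIV"
      by (rule bij_betwI[of _ _ _ uminus]) auto
    from has_sum_reindex_bij_betw[OF this, of "?b (q\<^sup>2)" "theta_pr (q\<^sup>2)"]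
    have "((\<lambda>n. ?b (q\<^sup>2) (- n)) has_sum theta_pr (q\<^sup>2)) UNIV"
      using sums(2) by (rule iffD2)
    ultimately show "((\<lambda>z. ?a q (fst (fst z + snd z, fst z - snd z + - 1)) * ?a q (snd (fst z + snd z, fst z - snd z + - 1)))
        has_sum q * (theta_pr (q\<^sup>2) * theta_pr (q\<^sup>2))) UNIV"
      using has_sum_cmult_right[OF has_sum_times_nonneg[OF _ _ sums(2)], of "\<lambda>n. ?b (q\<^sup>2) (- n)" "theta_pr (q\<^sup>2)" q] q
      by simp
  qed simp
  have "((\<lambda>z. ?a q (fst z) * ?a q (snd z)) has_sum (theta_sq q * theta_sq q)) UNIV"
    using theta_sq_has_sum[OF q] q by (intro has_sum_times_nonneg) simp_all
  from has_sum_unique[OF this 1]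
  show "(theta_sq q)\<^sup>2 = (theta_sq (q\<^sup>2))\<^sup>2 + q * (theta_pr (q\<^sup>2))\<^sup>2"
    by (simp only: power2_eq_square)
  have 2: "((\<lambda>z. ?b q (fst z) * ?b q (snd z)) has_sum
      (theta_pr (q\<^sup>2) * theta_sq (q\<^sup>2) + theta_sq (q\<^sup>2) * theta_pr (q\<^sup>2))) UNIV"
  \<comment> \<open>The shift by \<open>- 1\<close> cancels the terms linear in \<open>i\<close>, so
    the odd coset is the even one with the two series interchanged.\<close>
  proof (rule has_sum_int_parity[where c = "- 1"])
    have "?b q (i + j) * ?b q (i - j) = ?b (q\<^sup>2) i * ?a (q\<^sup>2) j" for i j :: int
      by (rule comb, simp add: power2_eq_square algebra_simps)
        (rule zero_le_power2 int_square_add_self_nonneg)+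
    then show "((\<lambda>z. ?b q (fst (fst z + snd z, fst z - snd z)) * ?b q (snd (fst z + snd z, fst z - snd z)))
        has_sum theta_pr (q\<^sup>2) * theta_sq (q\<^sup>2)) UNIV"
      using has_sum_times_nonneg[OF sums(2) _ sums(1)] q by simp
    have "?b q (i + j) * ?b q (i - j + - 1) = ?a (q\<^sup>2) i * ?b (q\<^sup>2) j" for i j :: int
      by (rule comb, simp add: power2_eq_square algebra_simps)
        (rule zero_le_power2 int_square_add_self_nonneg)+
    then show "((\<lambda>z. ?b q (fst (fst z + snd z, fst z - snd z + - 1)) * ?b q (snd (fst z + snd z, fst z - snd z + - 1)))
        has_sum theta_sq (q\<^sup>2) * theta_pr (q\<^sup>2)) UNIV"
      using has_sum_times_nonneg[OF sums(1) _ sums(2)] q by simp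
  qed simp
  have "((\<lambda>z. ?b q (fst z) * ?b q (snd z)) has_sum (theta_pr q * theta_pr q)) UNIV"
    using theta_pr_has_sum[OF q] q by (intro has_sum_times_nonneg) simp_all
  from has_sum_unique[OF this 2]
  show "(theta_pr q)\<^sup>2 = 2 * theta_sq (q\<^sup>2) * theta_pr (q\<^sup>2)"
    by (simp add: power2_eq_square algebra_simps)
qed

text \<open>Even indices have squares \<open>4 * n\<^sup>2\<close> and odd ones
  \<open>1 + 4 * (n\<^sup>2 + n)\<close>. Only \<open>u ^ 4\<close> matters, so the lemma serves
  both \<open>u = \<i> * sqrt q\<close> and \<open>u = - sqrt q\<close>.\<close>

lemma theta_complex_has_sum:
  fixes u :: complex and r :: real
  assumes r: "0 < r" "r < 1" and u: "u ^ 4 = of_real r"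
  shows "((\<lambda>n::int. u ^ nat (n\<^sup>2)) has_sum (of_real (theta_sq r) + u * of_real (theta_pr r))) UNIV"
proof -
  let ?f = "\<lambda>n::int. u ^ nat (n\<^sup>2)"
  have even: "?f (2 * n) = of_real (r ^ nat (n\<^sup>2))" for n
    using power_power_nat[of "n\<^sup>2" u 4] by (simp add: u power_mult_distrib)
  have odd: "?f (2 * n + 1) = u * of_real (r ^ nat (n\<^sup>2 + n))" for n
  proof -
    have "u * of_real (r ^ nat (n\<^sup>2 + n)) = u ^ nat 1 * u ^ nat (4 * (n\<^sup>2 + n))"
      using power_power_nat[OF int_square_add_self_nonneg[of n], of u 4] by (simp add: u)
    also have "\<dots> = u ^ nat (1 + 4 * (n\<^sup>2 + n))"
      using int_square_add_self_nonneg[of n] by (intro power_nat_mult) auto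
    also have "1 + 4 * (n\<^sup>2 + n) = (2 * n + 1)\<^sup>2"
      by (simp add: power2_eq_square algebra_simps)
    finally show ?thesis by simp
  qed
  have inj: "inj (\<lambda>n::int. 2 * n)" "inj (\<lambda>n::int. 2 * n + 1)"
    by (auto simp: inj_def)
  have "(?f has_sum of_real (theta_sq r)) (range (\<lambda>n. 2 * n))"
    using has_sum_of_real[OF theta_sq_has_sum[OF r], where 'a = complex]
    by (simp only: has_sum_reindex[OF inj(1)] o_def even)
  moreover have "(?f has_sum u * of_real (theta_pr r)) (range (\<lambda>n. 2 * n + 1))"
    using has_sum_cmult_right[OF has_sum_of_real[OF theta_pr_has_sum[OF r], where 'a = complex], of u]
    by (simp only: has_sum_reindex[OF inj(2)] o_def odd)
  moreover have "2 * m \<noteq> 2 * n + 1" for m n :: int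
    by presburger
  then have "range (\<lambda>n::int. 2 * n) \<inter> range (\<lambda>n. 2 * n + 1) = {}"
    by blast
  ultimately have "(?f has_sum (of_real (theta_sq r) + u * of_real (theta_pr r)))
      (range (\<lambda>n. 2 * n) \<union> range (\<lambda>n. 2 * n + 1))"
    by (rule has_sum_Un_disjoint)
  moreover have "n \<in> range (\<lambda>n. 2 * n) \<union> range (\<lambda>n. 2 * n + 1)" for n :: int
    by (cases "even n") (blast elim: evenE oddE)+
  then have "range (\<lambda>n::int. 2 * n) \<union> range (\<lambda>n. 2 * n + 1) = UNIV"
    by blast
  ultimately show ?thesis
    by simp
qed

section \<open>The singular modulus\<close>

lemma complex_product_theta:
  fixes u :: complex and r :: real
  assumes u: "norm u < 1" "u \<noteq> 0" and r: "0 < r" "r < 1" "u ^ 4 = of_real r"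
  obtains W Q where "(\<lambda>N. \<Prod>j<N. 1 + u * (u\<^sup>2) ^ j) \<longlonglongrightarrow> W" "W \<noteq> 0"
    "qfact (u\<^sup>2) \<longlonglongrightarrow> Q" "Q \<noteq> 0"
    "W\<^sup>2 * Q = of_real (theta_sq r) + u * of_real (theta_pr r)"
proof -
  have p: "norm (u\<^sup>2) < 1"
    using u by (simp add: norm_power power_less_one_iff)
  obtain W where W: "(\<lambda>N. \<Prod>j<N. 1 + u * (u\<^sup>2) ^ j) \<longlonglongrightarrow> W" "W \<noteq> 0"
    using tendsto_prod_geometric_nonzero[OF u(1) p] .
  obtain Q where Q: "qfact (u\<^sup>2) \<longlonglongrightarrow> Q" "Q \<noteq> 0"
    using qfact_tendsto[OF p] .
  have "W\<^sup>2 * Q = of_real (theta_sq r) + u * of_real (theta_pr r)"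
    by (rule has_sum_unique[OF theta_triple_product[OF u W(1) Q] theta_complex_has_sum[OF r]])
  then show ?thesis
    using that W Q by blast
qed

section \<open>The modulus and the double angle as theta quotients\<close>

text \<open>The classical \<open>\<theta>\<^sub>2(q)^2 / \<theta>\<^sub>3(q)^2\<close>;
  \<open>sqrt q\<close> is the square of the factor \<open>q^(1/4)\<close> left out of
  \<open>theta_pr\<close>.\<close>

definition theta_modulus :: "real \<Rightarrow> real" where
  "theta_modulus q = sqrt q * (theta_pr q)\<^sup>2 / (theta_sq q)\<^sup>2"

text \<open>The quotient \<open>\<theta>\<^sub>2 / \<theta>\<^sub>3\<close> at nome
  \<open>q\<^sup>2\<close>, whose fourth root is \<open>sqrt q\<close>. It turns out to be the
  tangent of twice the angle with tangent \<open>rgg q\<close>.\<close>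

definition theta_tan :: "real \<Rightarrow> real" where
  "theta_tan q = sqrt q * theta_pr (q\<^sup>2) / theta_sq (q\<^sup>2)"

context
  fixes q :: real
  assumes q: "0 < q" "q < 1"
begin

lemma q_square: "0 < q\<^sup>2" "q\<^sup>2 < 1"
  using q by (simp_all add: power_less_one_iff)

lemma theta_square_pos: "0 < theta_sq (q\<^sup>2)" "0 < theta_pr (q\<^sup>2)"
  using theta_sq_ge_1[OF q_square] theta_pr_ge_1[OF q_square] by auto

text \<open>With \<open>W = x + \<i> * y\<close> and \<open>rgg q = y / x\<close>, squaring
  \<open>W\<close> doubles the angle. The factor \<open>Q\<close> is real because
  \<open>u\<^sup>2\<close> is, so it cancels from the quotient of imaginary and real part.\<close>

lemma rgg_double_angle:
  shows "0 < rgg q" "rgg q < 1" "2 * rgg q / (1 - (rgg q)\<^sup>2) = theta_tan q"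
proof -
  define u where "u = \<i> * of_real (sqrt q)"
  have u2: "u\<^sup>2 = - of_real q"
    using q by (simp add: u_def power_mult_distrib flip: of_real_power)
  have "u ^ 4 = (u\<^sup>2)\<^sup>2"
    by simp
  also have "\<dots> = of_real (q\<^sup>2)"
    unfolding u2 by simp
  finally have u4: "u ^ 4 = of_real (q\<^sup>2)" .
  have u: "norm u < 1" "u \<noteq> 0"
    using q by (simp_all add: u_def norm_mult)
  obtain W Q where W: "(\<lambda>N. \<Prod>j<N. 1 + u * (u\<^sup>2) ^ j) \<longlonglongrightarrow> W"
    and Q: "qfact (u\<^sup>2) \<longlonglongrightarrow> Q"
    and WQ: "W\<^sup>2 * Q = of_real (theta_sq (q\<^sup>2)) + u * of_real (theta_pr (q\<^sup>2))"
    using complex_product_theta[OF u q_square u4] .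
  have "qfact (u\<^sup>2) n \<in> \<real>" for n
    unfolding qfact_def u2 by (intro prod_in_Reals Reals_diff Reals_1 Reals_power Reals_minus Reals_of_real)
  then have "Q \<in> \<real>"
    by (intro Lim_in_closed_set[OF closed_complex_Reals _ _ Q]) auto
  then obtain c where c: "Q = of_real c"
    by (elim Reals_cases)
  define x where "x = gg_sum q 0"
  define y where "y = sqrt q * gg_sum q 1"
  have pos: "0 < x" "0 < y"
    using q gg_sum_pos[OF q] by (simp_all add: x_def y_def)
  have "W = of_real x + \<i> * of_real y"
    using euler_prod_eq_gg_sum[OF q W[unfolded u_def]] by (simp add: x_def y_def)
  then have eq: "(of_real x + \<i> * of_real y)\<^sup>2 * of_real c =
      of_real (theta_sq (q\<^sup>2)) + \<i> * of_real (sqrt q * theta_pr (q\<^sup>2))"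
    using WQ by (simp add: c u_def)
  have re: "c * (x\<^sup>2 - y\<^sup>2) = theta_sq (q\<^sup>2)"
    using arg_cong[OF eq, of Re] by (simp add: power2_eq_square algebra_simps)
  have im: "c * (2 * x * y) = sqrt q * theta_pr (q\<^sup>2)"
    using arg_cong[OF eq, of Im] by (simp add: power2_eq_square algebra_simps)
  \<comment> \<open>The imaginary part determines the sign of \<open>c\<close>; the real part then
    gives \<open>y < x\<close>, that is \<open>rgg q < 1\<close>.\<close>
  have "0 < c * (2 * x * y)"
    unfolding im using q theta_square_pos by simp
  then have "0 < c"
    by (rule zero_less_mult_pos2) (use pos in simp)
  moreover have "0 < c * (x\<^sup>2 - y\<^sup>2)"
    unfolding re by (rule theta_square_pos)
  ultimately have "y\<^sup>2 < x\<^sup>2"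
    by (simp add: zero_less_mult_iff)
  then have "y < x"
    using pos by (simp add: power2_less_imp_less)
  have H: "rgg q = y / x"
    by (simp add: rgg_eq_gg_sum[OF q] x_def y_def)
  show "0 < rgg q" "rgg q < 1"
    using pos \<open>y < x\<close> by (simp_all add: H)
  have "2 * rgg q / (1 - (rgg q)\<^sup>2) = 2 * x * y / (x\<^sup>2 - y\<^sup>2)"
    using pos \<open>y\<^sup>2 < x\<^sup>2\<close> by (simp add: H field_simps power2_eq_square)
  also have "\<dots> = c * (2 * x * y) / (c * (x\<^sup>2 - y\<^sup>2))"
    using \<open>0 < c\<close> by simp
  also have "\<dots> = theta_tan q"
    by (simp only: re im theta_tan_def)
  finally show "2 * rgg q / (1 - (rgg q)\<^sup>2) = theta_tan q" .
qed

lemma theta_tan_pos: "0 < theta_tan q"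
  using q theta_square_pos by (simp add: theta_tan_def)

lemma theta_tan_square: "(theta_tan q)\<^sup>2 = theta_modulus (q\<^sup>2)"
  using q by (simp add: theta_tan_def theta_modulus_def power_mult_distrib power_divide)

text \<open>A consequence of the duplication formulas. Together with \<open>theta_tan_square\<close>
  it is Landen's relation between the moduli at \<open>q\<close> and
  \<open>q\<^sup>2\<close>.\<close>

lemma theta_modulus_eq_tan: "theta_modulus q = 2 * theta_tan q / (1 + (theta_tan q)\<^sup>2)"
proof -
  let ?a = "theta_sq (q\<^sup>2)" and ?b = "theta_pr (q\<^sup>2)"
  have "theta_modulus q = 2 * sqrt q * ?a * ?b / (?a\<^sup>2 + q * ?b\<^sup>2)"
    by (simp add: theta_modulus_def theta_double[OF q])
  also have "\<dots> = 2 * (sqrt q * ?b / ?a) / (1 + (sqrt q * ?b / ?a)\<^sup>2)"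
  proof -
    have "1 + (sqrt q * ?b / ?a)\<^sup>2 = (?a\<^sup>2 + q * ?b\<^sup>2) / ?a\<^sup>2"
      using q theta_square_pos by (simp add: power_mult_distrib power_divide add_divide_distrib)
    then show ?thesis
      using theta_square_pos by (simp add: power2_eq_square)
  qed
  finally show ?thesis
    by (simp only: theta_tan_def)
qed

text \<open>Equality would make the theta series vanish at \<open>u = - sqrt q\<close>, but there it
  factors as \<open>W\<^sup>2 * Q\<close> with both factors nonzero.\<close>

lemma theta_tan_neq_1: "theta_tan q \<noteq> 1"
proof
  assume "theta_tan q = 1"
  then have 1: "theta_sq (q\<^sup>2) - sqrt q * theta_pr (q\<^sup>2) = 0"
    using theta_square_pos by (simp add: theta_tan_def)
  define u where "u = complex_of_real (- sqrt q)"
  have u: "norm u < 1" "u \<noteq> 0"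
    using q by (simp_all add: u_def)
  have "(- sqrt q) ^ 4 = ((- sqrt q)\<^sup>2)\<^sup>2"
    by simp
  also have "\<dots> = q\<^sup>2"
    using q by simp
  finally have u4: "u ^ 4 = of_real (q\<^sup>2)"
    by (simp only: u_def of_real_power[symmetric])
  obtain W Q where "W \<noteq> 0" "Q \<noteq> 0"
    and "W\<^sup>2 * Q = of_real (theta_sq (q\<^sup>2)) + u * of_real (theta_pr (q\<^sup>2))"
    using complex_product_theta[OF u q_square u4] .
  moreover have "of_real (theta_sq (q\<^sup>2)) + u * of_real (theta_pr (q\<^sup>2)) =
      complex_of_real (theta_sq (q\<^sup>2) - sqrt q * theta_pr (q\<^sup>2))"
    by (simp add: u_def)
  ultimately show False
    by (simp add: 1)
qed

lemma theta_modulus_pos: "0 < theta_modulus q"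
  unfolding theta_modulus_eq_tan using theta_tan_pos by (intro divide_pos_pos add_pos_nonneg) auto

lemma theta_modulus_less_1: "theta_modulus q < 1"
proof -
  have "0 < (1 - theta_tan q)\<^sup>2"
    using theta_tan_neq_1 by simp
  then have "2 * theta_tan q < 1 + (theta_tan q)\<^sup>2"
    by (simp add: power2_eq_square algebra_simps)
  then show ?thesis
    using theta_modulus_eq_tan theta_tan_pos
    by (simp add: divide_less_eq_1 add_pos_nonneg)
qed

lemma theta_modulus_le: "theta_modulus q \<le> 4 * sqrt q"
proof -
  have "theta_pr q / theta_sq q \<le> 2"
    using theta_pr_le[OF q] theta_sq_ge_1[OF q] by (simp add: divide_le_eq)
  moreover have "0 \<le> theta_pr q / theta_sq q"
    using theta_pr_ge_1[OF q] theta_sq_ge_1[OF q] by simp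
  ultimately have "(theta_pr q / theta_sq q)\<^sup>2 \<le> 2\<^sup>2"
    by (rule power_mono)
  then have "sqrt q * (theta_pr q / theta_sq q)\<^sup>2 \<le> sqrt q * 4"
    using q by (intro mult_left_mono) auto
  then show ?thesis
    by (simp add: theta_modulus_def power_divide mult.commute)
qed

lemma theta_modulus_ge: "sqrt q / (theta_sq q)\<^sup>2 \<le> theta_modulus q"
proof -
  have "1 \<le> (theta_pr q)\<^sup>2"
    using theta_pr_ge_1[OF q] by (simp add: one_le_power)
  then have "sqrt q * 1 / (theta_sq q)\<^sup>2 \<le> sqrt q * (theta_pr q)\<^sup>2 / (theta_sq q)\<^sup>2"
    using q by (intro divide_right_mono mult_left_mono) auto
  then show ?thesis
    by (simp add: theta_modulus_def)
qed

end

text \<open>Placed outside the context because \<open>theta_modulus_less_1\<close> is needed at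
  \<open>q\<^sup>2\<close> rather than at \<open>q\<close>.\<close>

lemma theta_tan_less_1:
  assumes "0 < q" "q < 1"
  shows "theta_tan q < 1"
proof -
  have "(theta_tan q)\<^sup>2 < 1"
    unfolding theta_tan_square[OF assms] by (rule theta_modulus_less_1[OF q_square[OF assms]])
  then show ?thesis
    by (simp add: abs_square_less_1)
qed

section \<open>The ratio of elliptic integrals at the theta modulus\<close>

definition ellK_ratio :: "real \<Rightarrow> real" where
  "ellK_ratio k = ellK (sqrt (1 - k\<^sup>2)) / ellK k"

lemma ellK_ratio_theta_modulus_square:
  assumes q: "0 < q" "q < 1"
  shows "ellK_ratio (theta_modulus (q\<^sup>2)) = 2 * ellK_ratio (theta_modulus q)"
proof -
  let ?x = "theta_modulus (q\<^sup>2)"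
  have "sqrt ?x = theta_tan q"
    using theta_tan_pos[OF q] by (simp add: theta_tan_square[OF q, symmetric])
  then have "theta_modulus q = 2 * sqrt ?x / (1 + ?x)"
    by (simp add: theta_modulus_eq_tan[OF q] theta_tan_square[OF q])
  then show ?thesis
    using ellK_ratio_landen[of ?x] theta_modulus_pos[OF q_square[OF q]] theta_modulus_less_1[OF q_square[OF q]]
    by (simp add: ellK_ratio_def)
qed

lemma ellK_ratio_theta_modulus_power:
  assumes q: "0 < q" "q < 1"
  shows "ellK_ratio (theta_modulus (q ^ 2 ^ n)) = 2 ^ n * ellK_ratio (theta_modulus q)"
proof (induction n)
  case (Suc n)
  have "0 < q ^ 2 ^ n" "q ^ 2 ^ n < 1"
    using q by (simp_all add: power_less_one_iff)
  from ellK_ratio_theta_modulus_square[OF this] show ?case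
    by (simp add: Suc mult.commute flip: power_mult)
qed simp

text \<open>Along the nomes \<open>p n\<close> the ratio is \<open>2 ^ n * R\<close>, while
  \<open>ln (1 / k n)\<close> differs from \<open>2 ^ n * (pi * s / 2)\<close> by a bounded amount.
  Dividing the two-sided bounds by \<open>2 ^ n\<close> squeezes \<open>R\<close> to
  \<open>s\<close>.\<close>

lemma ellK_ratio_theta_modulus:
  fixes s :: real
  assumes "0 < s"
  defines "q \<equiv> exp (- pi * s)"
  shows "ellK_ratio (theta_modulus q) = s"
proof -
  have q: "0 < q" "q < 1"
    using assms by (simp_all add: q_def)
  define A where "A = theta_sq q"
  have A: "1 \<le> A"
    unfolding A_def by (rule theta_sq_ge_1[OF q])
  define R where "R = ellK_ratio (theta_modulus q)"
  define p where "p = (\<lambda>n::nat. q ^ 2 ^ n)"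
  define k where "k = (\<lambda>n. theta_modulus (p n))"
  define c where "c = (\<lambda>n. sqrt (1 - (k n)\<^sup>2))"
  have p: "0 < p n" "p n < 1" for n
    using q by (simp_all add: p_def power_less_one_iff)
  have k: "0 < k n" "k n < 1" for n
    unfolding k_def by (rule theta_modulus_pos[OF p] theta_modulus_less_1[OF p])+
  have ln_p: "ln (sqrt (p n)) = - (2 ^ n * (pi * s / 2))" for n
    using p[of n] q by (simp add: ln_sqrt p_def ln_realpow) (simp add: q_def)
  \<comment> \<open>Since \<open>p n \<le> q\<close>, the constant \<open>A\<close> bounds
    \<open>theta_sq (p n)\<close> for every \<open>n\<close>, whence
    \<open>k n \<ge> sqrt (p n) / A\<^sup>2\<close>.\<close>
  have upper: "ln (2 / k n) \<le> 2 ^ n * (pi * s / 2) + ln (2 * A\<^sup>2)" for n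
  proof -
    have "theta_sq (p n) \<le> A"
      unfolding A_def using q p by (intro theta_sq_mono) (auto simp: p_def intro: power_le_one self_le_power power_decreasing[of 1, simplified])
    then have "(theta_sq (p n))\<^sup>2 \<le> A\<^sup>2"
      using theta_sq_ge_1[OF p] by (intro power_mono) (auto intro: order_trans[OF zero_le_one])
    then have "sqrt (p n) / A\<^sup>2 \<le> sqrt (p n) / (theta_sq (p n))\<^sup>2"
      using theta_sq_ge_1[OF p, of n] p[of n] A by (intro divide_left_mono mult_pos_pos zero_less_power) auto
    also have "\<dots> \<le> k n"
      unfolding k_def by (rule theta_modulus_ge[OF p])
    finally have "2 / k n \<le> 2 / (sqrt (p n) / A\<^sup>2)"
      using k[of n] p[of n] A by (intro divide_left_mono) auto
    then have "ln (2 / k n) \<le> ln (2 * A\<^sup>2 / sqrt (p n))"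
      using k[of n] by (intro ln_mono) auto
    also have "\<dots> = ln (2 * A\<^sup>2) - ln (sqrt (p n))"
      using p[of n] A by (subst ln_div) auto
    finally show ?thesis
      by (simp add: ln_p)
  qed
  have lower: "2 ^ n * (pi * s / 2) - ln 4 \<le> ln (1 / k n)" for n
  proof -
    have "k n \<le> 4 * sqrt (p n)"
      unfolding k_def by (rule theta_modulus_le[OF p])
    then have "ln (k n) \<le> ln (4 * sqrt (p n))"
      using k[of n] by (intro ln_mono) auto
    also have "\<dots> = ln 4 + ln (sqrt (p n))"
      using p[of n] by (subst ln_mult) auto
    finally show ?thesis
      using k[of n] by (simp add: ln_div ln_p)
  qed
  have Rn: "ellK_ratio (k n) = 2 ^ n * R" for n
    unfolding k_def p_def R_def by (rule ellK_ratio_theta_modulus_power[OF q])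
  have p_lim: "p \<longlonglongrightarrow> 0"
  proof (rule Lim_null_comparison)
    show "(\<lambda>n. q ^ n) \<longlonglongrightarrow> 0"
      using q by (intro LIMSEQ_power_zero) auto
    have "p n \<le> q ^ n" for n
      unfolding p_def using q by (intro power_decreasing) auto
    then show "\<forall>\<^sub>F n in sequentially. norm (p n) \<le> q ^ n"
      using p by (simp add: less_imp_le)
  qed
  have "(\<lambda>n. 4 * sqrt (p n)) \<longlonglongrightarrow> 4 * sqrt 0"
    by (intro tendsto_intros p_lim)
  then have "k \<longlonglongrightarrow> 0"
    using k theta_modulus_le[OF p]
    by (intro Lim_null_comparison[of k "\<lambda>n. 4 * sqrt (p n)"]) (auto simp: k_def less_imp_le)
  then have "c \<longlonglongrightarrow> sqrt (1 - 0\<^sup>2)"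
    unfolding c_def by (intro tendsto_intros)
  then have c_lim: "c \<longlonglongrightarrow> 1"
    by simp
  have cpos: "0 < c n" for n
    using k[of n] by (simp add: c_def abs_square_less_1)
  have half: "(\<lambda>n. (1 / 2) ^ n) \<longlonglongrightarrow> (0::real)"
    by (intro LIMSEQ_power_zero) auto
  have "s \<le> R"
  proof (rule LIMSEQ_le_const2)
    show "(\<lambda>n. 2 / pi * c n * (pi * s / 2 - ln 4 * (1 / 2) ^ n)) \<longlonglongrightarrow> s"
    proof -
      have "(\<lambda>n. 2 / pi * c n * (pi * s / 2 - ln 4 * (1 / 2) ^ n)) \<longlonglongrightarrow> 2 / pi * 1 * (pi * s / 2 - ln 4 * 0)"
        by (intro tendsto_intros c_lim half)
      then show ?thesis
        by simp
    qed
    have "2 / pi * c n * (pi * s / 2 - ln 4 * (1 / 2) ^ n) \<le> R" for n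
    proof -
      have "2 / pi * c n * (2 ^ n * (pi * s / 2) - ln 4) \<le> 2 / pi * c n * ln (1 / k n)"
        using cpos[of n] lower[of n] by (intro mult_left_mono) auto
      also have "\<dots> \<le> 2 ^ n * R"
        unfolding Rn[symmetric] c_def ellK_ratio_def by (rule ellK_ratio_bounds(1)[OF k])
      finally have "2 / pi * c n * (2 ^ n * (pi * s / 2) - ln 4) / 2 ^ n \<le> R"
        by (simp only: pos_divide_le_eq zero_less_power zero_less_numeral mult.commute[of R])
      then have "2 / pi * c n * ((2 ^ n * (pi * s / 2) - ln 4) / 2 ^ n) \<le> R"
        by (simp only: times_divide_eq_right)
      moreover have "(2 ^ n * (pi * s / 2) - ln 4) / 2 ^ n = pi * s / 2 - ln 4 * (1 / 2) ^ n"
        by (simp add: diff_divide_distrib power_one_over)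
      ultimately show ?thesis
        by (simp only:)
    qed
    then show "\<exists>N. \<forall>n\<ge>N. 2 / pi * c n * (pi * s / 2 - ln 4 * (1 / 2) ^ n) \<le> R"
      by blast
  qed
  moreover have "R \<le> s"
  proof (rule LIMSEQ_le_const)
    let ?b = "\<lambda>n. (2 / pi * (pi * s / 2 + ln (2 * A\<^sup>2) * (1 / 2) ^ n) + (1 / 2) ^ n) / c n"
    show "?b \<longlonglongrightarrow> s"
    proof -
      have "?b \<longlonglongrightarrow> (2 / pi * (pi * s / 2 + ln (2 * A\<^sup>2) * 0) + 0) / 1"
        by (intro tendsto_intros c_lim half) simp
      then show ?thesis
        by simp
    qed
    have "R \<le> ?b n" for n
    proof -
      have "2 ^ n * R \<le> (2 / pi * ln (2 / k n) + 1) / c n"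
        unfolding Rn[symmetric] c_def ellK_ratio_def by (rule ellK_ratio_bounds(2)[OF k])
      also have "\<dots> \<le> (2 / pi * (2 ^ n * (pi * s / 2) + ln (2 * A\<^sup>2)) + 1) / c n"
        using cpos[of n] upper[of n] by (intro divide_right_mono add_right_mono mult_left_mono) auto
      finally have "R \<le> (2 / pi * (2 ^ n * (pi * s / 2) + ln (2 * A\<^sup>2)) + 1) / c n / 2 ^ n"
        by (simp only: pos_le_divide_eq zero_less_power zero_less_numeral mult.commute[of R])
      also have "\<dots> = ?b n"
        by (simp add: add_divide_distrib power_one_over distrib_left mult.commute)
      finally show ?thesis .
    qed
    then show "\<exists>N. \<forall>n\<ge>N. R \<le> ?b n"
      by blast
  qed
  ultimately show ?thesis
    by (simp add: R_def)
qed

text \<open>The rest is trigonometry in rational form: for \<open>H = tan a\<close> one has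
  \<open>t = tan (2a)\<close>, modulus \<open>sin (4a)\<close>, complementary modulus
  \<open>cos (4a)\<close> and \<open>P = cot (2a)\<close>.\<close>

theorem theorem3p1:
  fixes r q P :: real
  assumes "r > 0"
    and "q = exp (- pi * sqrt r)"
    and "P = sing_mod r / (1 - sing_mod_compl r)"
  shows "rgg q = - P + sqrt (P\<^sup>2 + 1) \<and>
         sing_mod r = 4 * (rgg q - rgg q ^ 3) / (1 + (rgg q)\<^sup>2)\<^sup>2"
proof -
  have q: "0 < q" "q < 1"
    using assms by simp_all
  define H where "H = rgg q"
  define t where "t = theta_tan q"
  have H: "0 < H" "H < 1" and t: "t = 2 * H / (1 - H\<^sup>2)"
    using rgg_double_angle[OF q] by (simp_all add: H_def t_def)
  have t01: "0 < t" "t < 1"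
    unfolding t_def by (rule theta_tan_pos[OF q] theta_tan_less_1[OF q])+
  have H2: "H\<^sup>2 < 1"
    using H by (simp add: power_less_one_iff)
  have t2: "0 < 1 + t\<^sup>2" "t\<^sup>2 < 1"
    using t01 by (simp_all add: add_pos_nonneg power_less_one_iff)
  have "sing_mod r = theta_modulus q"
    using ellK_ratio_theta_modulus[of "sqrt r"] theta_modulus_pos[OF q] theta_modulus_less_1[OF q] assms(1,2)
    by (intro sing_mod_eqI) (auto simp: ellK_ratio_def)
  then have k: "sing_mod r = 2 * t / (1 + t\<^sup>2)"
    by (simp add: theta_modulus_eq_tan[OF q] t_def)
  have "1 - (sing_mod r)\<^sup>2 = ((1 - t\<^sup>2) / (1 + t\<^sup>2))\<^sup>2"
    unfolding k power_divide using t2 by (simp add: divide_simps) (simp add: power2_eq_square algebra_simps)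
  \<comment> \<open>Here \<open>t < 1\<close> selects the sign of the square root.\<close>
  then have "sing_mod_compl r = (1 - t\<^sup>2) / (1 + t\<^sup>2)"
    using t2 by (simp add: sing_mod_compl_def)
  then have "1 - sing_mod_compl r = 2 * t\<^sup>2 / (1 + t\<^sup>2)"
    using t2 by (simp add: field_simps)
  then have "P = 1 / t"
    unfolding assms(3) k using t01 t2 by (simp add: power2_eq_square)
  then have P: "P = (1 - H\<^sup>2) / (2 * H)"
    by (simp add: t)
  have "P\<^sup>2 + 1 = ((1 + H\<^sup>2) / (2 * H))\<^sup>2"
    unfolding P power_divide using H by (simp add: divide_simps) (simp add: power2_eq_square algebra_simps)
  then have "sqrt (P\<^sup>2 + 1) = (1 + H\<^sup>2) / (2 * H)"
    using H by simp
  then have 1: "H = - P + sqrt (P\<^sup>2 + 1)"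
    unfolding P using H by (simp add: field_simps power2_eq_square)
  have "1 + t\<^sup>2 = (1 + H\<^sup>2)\<^sup>2 / (1 - H\<^sup>2)\<^sup>2"
    unfolding t power_divide using H2 by (simp add: divide_simps) (simp add: power2_eq_square algebra_simps)
  then have "sing_mod r = 2 * t * (1 - H\<^sup>2)\<^sup>2 / (1 + H\<^sup>2)\<^sup>2"
    by (simp add: k)
  also have "2 * t * (1 - H\<^sup>2)\<^sup>2 = 4 * (H - H ^ 3)"
    unfolding t using H2 by (simp add: power2_eq_square power3_eq_cube) (simp add: algebra_simps)
  finally show ?thesis
    using 1 by (simp add: H_def)
qed

end
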